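(* (Gauge Uniqueness Theorem) Let $(\mathcal{B},\mathcal{L},\theta)$ be a Boolean dynamical system, and let $\{P_A,S_\alpha\}$ be a Cuntz-Krieger representation of $(\mathcal{B},\mathcal{L},\theta)$ in a $C^*$-algebra $\mathcal{A}$. Suppose that $P_A\neq0$ whenever $A\neq\emptyset$, and that there is a strongly continuous action $\gamma$ of $\mathbb{T}$ on $C^*(P_A,S_\alpha)\subseteq\mathcal{A}$ such that $\gamma_z\circ\pi_{S,P}=\pi_{S,P}\circ\beta_z$ for all $z\in\mathbb{T}$. Then $\pi_{S,P}:C^*(\mathcal{B},\mathcal{L},\theta)\to\mathcal{A}$ is injective.
   Context: A Boolean algebra $\mathcal{B}$ here is a set with a distinguished element $\emptyset$ and operations $\cap,\cup,\setminus$ satisfying the usual axioms (a Boolean ring; no top element required); $A\subseteq B$ iff $A\cap B=A$. An action on $\mathcal{B}$ is a map $\theta:\mathcal{B}\to\mathcal{B}$ preserving $\cap,\cup,\setminus$ and $\emptyset$; it has compact range if $\{\theta(A)\}_{A\in\mathcal{B}}$ has a least upper bound $\mathcal{R}_\theta\in\mathcal{B}$, and closed domain if there is (a fixed) $\mathcal{D}_\theta\in\mathcal{B}$ with $\theta(\mathcal{D}_\theta)=\mathcal{R}_\theta$. A Boolean dynamical system $(\mathcal{B},\mathcal{L},\theta)$ consists of a Boolean algebra, a set $\mathcal{L}$, and actions $\{\theta_\alpha\}_{\alpha\in\mathcal{L}}$ such that for every nonempty word $\alpha=\alpha_1\cdots\alpha_n$ in $\mathcal{L}$ the action $\theta_\alpha=\theta_{\alpha_n}\circ\cdots\circ\theta_{\alpha_1}$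 has compact range $\mathcal{R}_\alpha$ and closed domain $\mathcal{D}_\alpha$. $\Delta_B=\{\alpha\in\mathcal{L}:\theta_\alpha(B)\ne\emptyset\}$, $\lambda_B=|\Delta_B|$; $\mathcal{B}_{reg}$ is the set of $A$ with $0<\lambda_B<\infty$ for all $\emptyset\neq B\subseteq A$ (including $\emptyset$). A Cuntz-Krieger representation in a $C^*$-algebra $\mathcal{A}$ consists of projections $\{P_A\}_{A\in\mathcal{B}}$ and partial isometries $\{S_\alpha\}_{\alpha\in\mathcal{L}}$ with: (1) $P_AP_B=P_{A\cap B}$, $P_{A\cup B}=P_A+P_B-P_{A\cap B}$, $P_\emptyset=0$; (2) $P_AS_\alpha=S_\alpha P_{\theta_\alpha(A)}$; (3) $S_\alpha^*S_\beta=\delta_{\alpha,\beta}P_{\mathcal{R}_\alpha}$; (4) $P_A=\sum_{\alpha\in\Delta_A}S_\alpha P_{\theta_\alpha(A)}S_\alpha^*$ for $A\in\mathcal{B}_{reg}$. $C^*(P_A,S_\alpha)$ is the $C^*$-subalgebra they generate. $C^*(\mathcal{B},\mathcal{L},\theta)$ is the $C^*$-algebra generated by the universal Cuntz-Krieger representation $\{p_A,s_\alpha\}$, and $\pi_{S,P}:C^*(\mathcal{B},\mathcal{L},\theta)\to\mathcal{A}$ is the $*$-homomorphism with $p_A\mapsto P_A$, $s_\alpha\mapsto S_\alpha$. The gauge action $\beta$ of $\mathbb{T}$ on $C^*(\mathcal{B},\mathcal{L},\theta)$ is the strongly continuous action with $\beta_z(p_A)=p_A$, $\beta_z(s_\alpha)=zs_\alpha$.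 *)

theory Defs
  imports "HOL-Analysis.Analysis"
begin

section \<open>Boolean dynamical systems\<close>

text \<open>
  Boolean algebras without a required top element (Boolean rings). The order is the one given by
  \<open>A \<le> B \<longleftrightarrow> inf A B = A\<close>, and \<open>A - B\<close> is the relative complement.
\<close>

class generalized_boolean_algebra = distrib_lattice + bounded_lattice_bot + minus +
  assumes inf_relative_compl: "inf y (x - y) = bot"
    and sup_relative_compl: "sup (inf x y) (x - y) = x"

definition boolean_action :: "('b::generalized_boolean_algebra \<Rightarrow> 'b) \<Rightarrow> bool" where
  "boolean_action f \<longleftrightarrow>
     f bot = bot \<and>
     (\<forall>A B. f (inf A B) = inf (f A) (f B)) \<and>
     (\<forall>A B. f (sup A B) = sup (f A) (f B)) \<and>
     (\<forall>A B. f (A - B) = f A - f B)"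

definition is_lub :: "'b::order set \<Rightarrow> 'b \<Rightarrow> bool" where
  "is_lub X R \<longleftrightarrow> (\<forall>A\<in>X. A \<le> R) \<and> (\<forall>C. (\<forall>A\<in>X. A \<le> C) \<longrightarrow> R \<le> C)"

definition compact_range :: "('b::generalized_boolean_algebra \<Rightarrow> 'b) \<Rightarrow> bool" where
  "compact_range f \<longleftrightarrow> (\<exists>R. is_lub (range f) R)"

definition range_top :: "('b::generalized_boolean_algebra \<Rightarrow> 'b) \<Rightarrow> 'b" where
  "range_top f = (THE R. is_lub (range f) R)"

definition closed_domain :: "('b::generalized_boolean_algebra \<Rightarrow> 'b) \<Rightarrow> bool" where
  "closed_domain f \<longleftrightarrow> (\<exists>D. f D = range_top f)"

text \<open>
  The underlying Boolean algebra is the type \<open>'b\<close>. The label set is a subset \<open>L\<close> of the type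
  \<open>'l\<close>, so that it may be empty. For a word \<open>w = [\<alpha>\<^sub>1, \<dots>, \<alpha>\<^sub>n]\<close> the term \<open>fold \<theta> w\<close> is
  \<open>\<theta> \<alpha>\<^sub>n \<circ> \<dots> \<circ> \<theta> \<alpha>\<^sub>1\<close>.
\<close>

definition boolean_dynamical_system ::
    "'l set \<Rightarrow> ('l \<Rightarrow> 'b::generalized_boolean_algebra \<Rightarrow> 'b) \<Rightarrow> bool" where
  "boolean_dynamical_system L \<theta> \<longleftrightarrow>
     (\<forall>\<alpha>\<in>L. boolean_action (\<theta> \<alpha>)) \<and>
     (\<forall>w. w \<noteq> [] \<and> set w \<subseteq> L \<longrightarrow> compact_range (fold \<theta> w) \<and> closed_domain (fold \<theta> w))"

definition labels_of ::
    "'l set \<Rightarrow> ('l \<Rightarrow> 'b::generalized_boolean_algebra \<Rightarrow> 'b) \<Rightarrow> 'b \<Rightarrow> 'l set" where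
  "labels_of L \<theta> B = {\<alpha>\<in>L. \<theta> \<alpha> B \<noteq> bot}"

definition regular_elements ::
    "'l set \<Rightarrow> ('l \<Rightarrow> 'b::generalized_boolean_algebra \<Rightarrow> 'b) \<Rightarrow> 'b set" where
  "regular_elements L \<theta> =
     {A. \<forall>B. B \<noteq> bot \<and> B \<le> A \<longrightarrow>
           finite (labels_of L \<theta> B) \<and> 0 < card (labels_of L \<theta> B)}"


section \<open>C*-algebras\<close>

text \<open>
  C*-algebras are complex and need not have a unit. They appear in two forms: as a type class,
  and as structures with an explicit carrier. The second form is needed because a universal
  property quantifies over C*-algebras, which is not possible for instances of a type class.
\<close>

class scaleC = scaleR +
  fixes scaleC :: "complex \<Rightarrow> 'a \<Rightarrow> 'a"  (infixr \<open>*\<^sub>C\<close> 75)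

class star_involution =
  fixes star :: "'a \<Rightarrow> 'a"

class cstar_algebra = scaleC + star_involution + real_normed_algebra + banach +
  assumes scaleC_add_right: "a *\<^sub>C (x + y) = a *\<^sub>C x + a *\<^sub>C y"
    and scaleC_add_left: "(a + b) *\<^sub>C x = a *\<^sub>C x + b *\<^sub>C x"
    and scaleC_scaleC: "a *\<^sub>C b *\<^sub>C x = (a * b) *\<^sub>C x"
    and scaleR_eq_scaleC: "r *\<^sub>R x = complex_of_real r *\<^sub>C x"
    and mult_scaleC_left: "(a *\<^sub>C x) * y = a *\<^sub>C (x * y)"
    and mult_scaleC_right: "x * (a *\<^sub>C y) = a *\<^sub>C (x * y)"
    and norm_scaleC: "norm (a *\<^sub>C x) = cmod a * norm x"
    and star_star: "star (star x) = x"
    and star_add: "star (x + y) = star x + star y"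
    and star_scaleC: "star (a *\<^sub>C x) = cnj a *\<^sub>C star x"
    and star_mult: "star (x * y) = star y * star x"
    and cstar_identity: "norm (star x * x) = (norm x)\<^sup>2"

definition cstar_subalgebra :: "'a::cstar_algebra set \<Rightarrow> bool" where
  "cstar_subalgebra X \<longleftrightarrow>
     0 \<in> X \<and> (\<forall>x\<in>X. \<forall>y\<in>X. x + y \<in> X \<and> x * y \<in> X) \<and>
     (\<forall>x\<in>X. star x \<in> X \<and> (\<forall>a. a *\<^sub>C x \<in> X)) \<and> closed X"

record 'c cstar_structure =
  carrier :: "'c set"
  zero :: 'c  (\<open>\<zero>\<index>\<close>)
  add :: "'c \<Rightarrow> 'c \<Rightarrow> 'c"  (infixl \<open>\<oplus>\<index>\<close> 65)
  smult :: "complex \<Rightarrow> 'c \<Rightarrow> 'c"  (infixr \<open>\<odot>\<index>\<close> 75)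
  mult :: "'c \<Rightarrow> 'c \<Rightarrow> 'c"  (infixl \<open>\<otimes>\<index>\<close> 70)
  adj :: "'c \<Rightarrow> 'c"
  nrm :: "'c \<Rightarrow> real"

definition diff :: "('c, 'm) cstar_structure_scheme \<Rightarrow> 'c \<Rightarrow> 'c \<Rightarrow> 'c"
    (infixl \<open>\<ominus>\<index>\<close> 65) where
  "x \<ominus>\<^bsub>M\<^esub> y = x \<oplus>\<^bsub>M\<^esub> (-1) \<odot>\<^bsub>M\<^esub> y"

text \<open>For the addition of a type this is the usual finite sum, see \<open>finsum_cstar_on\<close> below.\<close>

definition finsum :: "('c, 'm) cstar_structure_scheme \<Rightarrow> ('i \<Rightarrow> 'c) \<Rightarrow> 'i set \<Rightarrow> 'c" where
  "finsum M f I = Finite_Set.fold (\<lambda>i x. f i \<oplus>\<^bsub>M\<^esub> x) \<zero>\<^bsub>M\<^esub> I"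

locale cstar_structure =
  fixes M :: "('c, 'm) cstar_structure_scheme" (structure)
  assumes zero_closed: "\<zero> \<in> carrier M"
    and add_closed: "\<lbrakk>x \<in> carrier M; y \<in> carrier M\<rbrakk> \<Longrightarrow> x \<oplus> y \<in> carrier M"
    and smult_closed: "x \<in> carrier M \<Longrightarrow> a \<odot> x \<in> carrier M"
    and mult_closed: "\<lbrakk>x \<in> carrier M; y \<in> carrier M\<rbrakk> \<Longrightarrow> x \<otimes> y \<in> carrier M"
    and adj_closed: "x \<in> carrier M \<Longrightarrow> adj M x \<in> carrier M"
    and add_assoc: "\<lbrakk>x \<in> carrier M; y \<in> carrier M; z \<in> carrier M\<rbrakk>
          \<Longrightarrow> (x \<oplus> y) \<oplus> z = x \<oplus> (y \<oplus> z)"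
    and add_commute: "\<lbrakk>x \<in> carrier M; y \<in> carrier M\<rbrakk> \<Longrightarrow> x \<oplus> y = y \<oplus> x"
    and add_zero: "x \<in> carrier M \<Longrightarrow> \<zero> \<oplus> x = x"
    and diff_self: "x \<in> carrier M \<Longrightarrow> x \<ominus> x = \<zero>"
    and smult_add_right: "\<lbrakk>x \<in> carrier M; y \<in> carrier M\<rbrakk>
          \<Longrightarrow> a \<odot> (x \<oplus> y) = a \<odot> x \<oplus> a \<odot> y"
    and smult_add_left: "x \<in> carrier M \<Longrightarrow> (a + b) \<odot> x = a \<odot> x \<oplus> b \<odot> x"
    and smult_smult: "x \<in> carrier M \<Longrightarrow> a \<odot> b \<odot> x = (a * b) \<odot> x"
    and smult_one: "x \<in> carrier M \<Longrightarrow> 1 \<odot> x = x"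
    and mult_assoc: "\<lbrakk>x \<in> carrier M; y \<in> carrier M; z \<in> carrier M\<rbrakk>
          \<Longrightarrow> (x \<otimes> y) \<otimes> z = x \<otimes> (y \<otimes> z)"
    and mult_add_left: "\<lbrakk>x \<in> carrier M; y \<in> carrier M; z \<in> carrier M\<rbrakk>
          \<Longrightarrow> (x \<oplus> y) \<otimes> z = x \<otimes> z \<oplus> y \<otimes> z"
    and mult_add_right: "\<lbrakk>x \<in> carrier M; y \<in> carrier M; z \<in> carrier M\<rbrakk>
          \<Longrightarrow> x \<otimes> (y \<oplus> z) = x \<otimes> y \<oplus> x \<otimes> z"
    and mult_smult_left: "\<lbrakk>x \<in> carrier M; y \<in> carrier M\<rbrakk>
          \<Longrightarrow> (a \<odot> x) \<otimes> y = a \<odot> (x \<otimes> y)"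
    and mult_smult_right: "\<lbrakk>x \<in> carrier M; y \<in> carrier M\<rbrakk>
          \<Longrightarrow> x \<otimes> (a \<odot> y) = a \<odot> (x \<otimes> y)"
    and adj_adj: "x \<in> carrier M \<Longrightarrow> adj M (adj M x) = x"
    and adj_add: "\<lbrakk>x \<in> carrier M; y \<in> carrier M\<rbrakk>
          \<Longrightarrow> adj M (x \<oplus> y) = adj M x \<oplus> adj M y"
    and adj_smult: "x \<in> carrier M \<Longrightarrow> adj M (a \<odot> x) = cnj a \<odot> adj M x"
    and adj_mult: "\<lbrakk>x \<in> carrier M; y \<in> carrier M\<rbrakk>
          \<Longrightarrow> adj M (x \<otimes> y) = adj M y \<otimes> adj M x"
    and nrm_nonneg: "x \<in> carrier M \<Longrightarrow> 0 \<le> nrm M x"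
    and nrm_eq_zero: "x \<in> carrier M \<Longrightarrow> nrm M x = 0 \<longleftrightarrow> x = \<zero>"
    and nrm_add: "\<lbrakk>x \<in> carrier M; y \<in> carrier M\<rbrakk> \<Longrightarrow> nrm M (x \<oplus> y) \<le> nrm M x + nrm M y"
    and nrm_smult: "x \<in> carrier M \<Longrightarrow> nrm M (a \<odot> x) = cmod a * nrm M x"
    and nrm_mult: "\<lbrakk>x \<in> carrier M; y \<in> carrier M\<rbrakk> \<Longrightarrow> nrm M (x \<otimes> y) \<le> nrm M x * nrm M y"
    and nrm_cstar: "x \<in> carrier M \<Longrightarrow> nrm M (adj M x \<otimes> x) = (nrm M x)\<^sup>2"
    and complete: "\<lbrakk>\<And>n::nat. X n \<in> carrier M;
          \<And>e. 0 < e \<Longrightarrow> \<exists>N. \<forall>m\<ge>N. \<forall>n\<ge>N. nrm M (X m \<ominus> X n) < e\<rbrakk>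
          \<Longrightarrow> \<exists>x\<in>carrier M. (\<lambda>n. nrm M (X n \<ominus> x)) \<longlonglongrightarrow> 0"

definition star_hom :: "('c, 'm) cstar_structure_scheme \<Rightarrow> ('d, 'n) cstar_structure_scheme \<Rightarrow>
    ('c \<Rightarrow> 'd) \<Rightarrow> bool" where
  "star_hom M N f \<longleftrightarrow>
     f ` carrier M \<subseteq> carrier N \<and>
     (\<forall>x\<in>carrier M. \<forall>y\<in>carrier M. f (x \<oplus>\<^bsub>M\<^esub> y) = f x \<oplus>\<^bsub>N\<^esub> f y) \<and>
     (\<forall>x\<in>carrier M. \<forall>y\<in>carrier M. f (x \<otimes>\<^bsub>M\<^esub> y) = f x \<otimes>\<^bsub>N\<^esub> f y) \<and>
     (\<forall>a. \<forall>x\<in>carrier M. f (a \<odot>\<^bsub>M\<^esub> x) = a \<odot>\<^bsub>N\<^esub> f x) \<and>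
     (\<forall>x\<in>carrier M. f (adj M x) = adj N (f x))"

text \<open>The C*-algebra with carrier \<open>X\<close> inside a C*-algebra given by a type.\<close>

definition cstar_on :: "'a::cstar_algebra set \<Rightarrow> 'a cstar_structure" where
  "cstar_on X = \<lparr>carrier = X, zero = 0, add = (+), smult = (*\<^sub>C), mult = (*), adj = star, nrm = norm\<rparr>"

abbreviation cstar_univ :: "'a::cstar_algebra cstar_structure" where
  "cstar_univ \<equiv> cstar_on UNIV"

lemma cstar_on_simps [simp]:
  "carrier (cstar_on X) = X" "zero (cstar_on X) = 0" "add (cstar_on X) = (+)"
  "smult (cstar_on X) = (*\<^sub>C)" "mult (cstar_on X) = (*)" "adj (cstar_on X) = star"
  "nrm (cstar_on X) = norm"
  by (simp_all add: cstar_on_def)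

lemma scaleC_one [simp]: "1 *\<^sub>C x = (x::'a::cstar_algebra)"
  using scaleR_eq_scaleC[of 1 x] by simp

lemma scaleC_minus_one [simp]: "(- 1) *\<^sub>C x = - (x::'a::cstar_algebra)"
  using scaleR_eq_scaleC[of "-1" x] by simp

lemma diff_cstar_on [simp]: "x \<ominus>\<^bsub>cstar_on X\<^esub> y = x - y"
  by (simp add: diff_def)

lemma finsum_cstar_on [simp]: "finsum (cstar_on X) f I = sum f I"
  by (simp add: finsum_def sum.eq_fold comp_def)

lemma cstar_structure_cstar_on:
  assumes "cstar_subalgebra X"
  shows "cstar_structure (cstar_on X)"
proof
  fix Y :: "nat \<Rightarrow> 'a"
  assume Y: "\<And>n. Y n \<in> carrier (cstar_on X)"
    and C: "\<And>e. 0 < e \<Longrightarrow> \<exists>N. \<forall>m\<ge>N. \<forall>n\<ge>N. nrm (cstar_on X) (Y m \<ominus>\<^bsub>cstar_on X\<^esub> Y n) < e"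
  have "Cauchy Y"
    using C by (simp add: Cauchy_def dist_norm)
  then obtain x where x: "Y \<longlonglongrightarrow> x"
    using Cauchy_convergent_iff convergent_def by blast
  moreover have "closed X"
    using assms by (simp add: cstar_subalgebra_def)
  ultimately have "x \<in> X"
    using Y closed_sequentially[of X Y x] by simp
  with x show "\<exists>x\<in>carrier (cstar_on X). (\<lambda>n. nrm (cstar_on X) (Y n \<ominus>\<^bsub>cstar_on X\<^esub> x)) \<longlonglongrightarrow> 0"
    by (auto simp: tendsto_norm_zero_iff LIM_zero_iff)
qed (use assms in \<open>auto simp: cstar_subalgebra_def scaleC_add_right scaleC_add_left scaleC_scaleC
      mult_scaleC_left mult_scaleC_right norm_scaleC star_star star_add star_scaleC star_mult
      cstar_identity algebra_simps norm_triangle_ineq norm_mult_ineq\<close>)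


section \<open>Cuntz--Krieger representations\<close>

definition projection :: "('c, 'm) cstar_structure_scheme \<Rightarrow> 'c \<Rightarrow> bool" where
  "projection M x \<longleftrightarrow> x \<in> carrier M \<and> adj M x = x \<and> x \<otimes>\<^bsub>M\<^esub> x = x"

definition partial_isometry :: "('c, 'm) cstar_structure_scheme \<Rightarrow> 'c \<Rightarrow> bool" where
  "partial_isometry M x \<longleftrightarrow> x \<in> carrier M \<and> x \<otimes>\<^bsub>M\<^esub> adj M x \<otimes>\<^bsub>M\<^esub> x = x"

definition ck_representation ::
    "'l set \<Rightarrow> ('l \<Rightarrow> 'b::generalized_boolean_algebra \<Rightarrow> 'b) \<Rightarrow>
     ('c, 'm) cstar_structure_scheme \<Rightarrow> ('b \<Rightarrow> 'c) \<Rightarrow> ('l \<Rightarrow> 'c) \<Rightarrow> bool" where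
  "ck_representation L \<theta> M P S \<longleftrightarrow>
     (\<forall>A. projection M (P A)) \<and>
     (\<forall>\<alpha>\<in>L. partial_isometry M (S \<alpha>)) \<and>
     (\<forall>A B. P A \<otimes>\<^bsub>M\<^esub> P B = P (inf A B)) \<and>
     (\<forall>A B. P (sup A B) = P A \<oplus>\<^bsub>M\<^esub> P B \<ominus>\<^bsub>M\<^esub> P (inf A B)) \<and>
     P bot = \<zero>\<^bsub>M\<^esub> \<and>
     (\<forall>A. \<forall>\<alpha>\<in>L. P A \<otimes>\<^bsub>M\<^esub> S \<alpha> = S \<alpha> \<otimes>\<^bsub>M\<^esub> P (\<theta> \<alpha> A)) \<and>
     (\<forall>\<alpha>\<in>L. \<forall>\<beta>\<in>L. adj M (S \<alpha>) \<otimes>\<^bsub>M\<^esub> S \<beta> =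
        (if \<alpha> = \<beta> then P (range_top (\<theta> \<alpha>)) else \<zero>\<^bsub>M\<^esub>)) \<and>
     (\<forall>A\<in>regular_elements L \<theta>.
        P A = finsum M (\<lambda>\<alpha>. S \<alpha> \<otimes>\<^bsub>M\<^esub> P (\<theta> \<alpha> A) \<otimes>\<^bsub>M\<^esub> adj M (S \<alpha>)) (labels_of L \<theta> A))"

definition ck_algebra ::
    "'l set \<Rightarrow> ('b \<Rightarrow> 'a::cstar_algebra) \<Rightarrow> ('l \<Rightarrow> 'a) \<Rightarrow> 'a set" where
  "ck_algebra L P S = cstar_subalgebra hull (range P \<union> S ` L)"

text \<open>
  \<open>universal_ck L \<theta> p s\<close> says that the C*-algebra \<open>'u\<close>, together with \<open>p\<close> and \<open>s\<close>, is
  \<open>C\<^sup>*(\<B>, \<L>, \<theta>)\<close>: it is generated by the Cuntz--Krieger representation \<open>(p, s)\<close>, and every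
  Cuntz--Krieger representation factors through it by a *-homomorphism, which is unique on
  account of generation.

  The test algebras \<open>M\<close> are the C*-algebras carried by subsets of the type \<open>nat \<Rightarrow> 'b + 'l\<close>.
  Up to isomorphism these include every C*-algebra generated by a Cuntz--Krieger representation,
  so this is the universal property for all C*-algebras: with \<open>\<kappa> = |'b + 'l|\<close>, the polynomials
  in the generators with coefficients in the Gaussian rationals form a dense set of at most
  \<open>max \<kappa> \<aleph>\<^sub>0\<close> elements, hence the generated C*-algebra has at most \<open>(max \<kappa> \<aleph>\<^sub>0)\<close> to the
  power \<open>\<aleph>\<^sub>0\<close> elements, and this is the cardinality of \<open>nat \<Rightarrow> 'b + 'l\<close>, as \<open>\<kappa> \<ge> 2\<close>.
\<close>

definition universal_ck ::
    "'l set \<Rightarrow> ('l \<Rightarrow> 'b::generalized_boolean_algebra \<Rightarrow> 'b) \<Rightarrow>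
     ('b \<Rightarrow> 'u::cstar_algebra) \<Rightarrow> ('l \<Rightarrow> 'u) \<Rightarrow> bool" where
  "universal_ck L \<theta> p s \<longleftrightarrow>
     ck_representation L \<theta> cstar_univ p s \<and>
     ck_algebra L p s = UNIV \<and>
     (\<forall>(M :: (nat \<Rightarrow> 'b + 'l) cstar_structure) P S.
        cstar_structure M \<and> ck_representation L \<theta> M P S \<longrightarrow>
        (\<exists>\<pi>. star_hom cstar_univ M \<pi> \<and> (\<forall>A. \<pi> (p A) = P A) \<and> (\<forall>\<alpha>\<in>L. \<pi> (s \<alpha>) = S \<alpha>)))"

text \<open>
  Strongly continuous actions of the circle group on the C*-algebra with carrier \<open>X\<close>.
  Only the values \<open>\<gamma> z x\<close> with \<open>|z| = 1\<close> and \<open>x \<in> X\<close> matter; each \<open>\<gamma> z\<close> is an automorphism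
  of \<open>X\<close>, with inverse \<open>\<gamma> (inverse z)\<close>.
\<close>

definition circle_action :: "'a::cstar_algebra set \<Rightarrow> (complex \<Rightarrow> 'a \<Rightarrow> 'a) \<Rightarrow> bool" where
  "circle_action X \<gamma> \<longleftrightarrow>
     (\<forall>z\<in>sphere 0 1. star_hom (cstar_on X) (cstar_on X) (\<gamma> z)) \<and>
     (\<forall>x\<in>X. \<gamma> 1 x = x) \<and>
     (\<forall>z\<in>sphere 0 1. \<forall>w\<in>sphere 0 1. \<forall>x\<in>X. \<gamma> (z * w) x = \<gamma> z (\<gamma> w x)) \<and>
     (\<forall>x\<in>X. continuous_on (sphere 0 1) (\<lambda>z. \<gamma> z x))"

definition gauge_action ::
    "'l set \<Rightarrow> ('b \<Rightarrow> 'u::cstar_algebra) \<Rightarrow> ('l \<Rightarrow> 'u) \<Rightarrow> (complex \<Rightarrow> 'u \<Rightarrow> 'u) \<Rightarrow> bool" where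
  "gauge_action L p s \<beta> \<longleftrightarrow>
     circle_action UNIV \<beta> \<and>
     (\<forall>z\<in>sphere 0 1. (\<forall>A. \<beta> z (p A) = p A) \<and> (\<forall>\<alpha>\<in>L. \<beta> z (s \<alpha>) = z *\<^sub>C s \<alpha>))"

end

theory Submission
  imports Defs
begin

text \<open>
  Write \<open>p\<close>, \<open>s\<close> for the generators of the universal algebra and \<open>P\<close>, \<open>S\<close> for their images under
  \<open>\<pi>\<close>. The proof shows \<open>\<parallel>x\<parallel> \<le> \<parallel>\<pi> x\<parallel>\<close> for every \<open>x\<close>. In place of spectral theory
  and a faithful conditional expectation, obtained by integration over the circle, it uses
  a power trick (\<open>norm_le_if_powers_linear\<close>). If \<open>h\<close> is self-adjoint, the C*-identity
  gives \<open>\<parallel>h\<^bsup>m\<^esup>\<parallel> = \<parallel>h\<parallel>\<^bsup>m\<^esup>\<close> for \<open>m = 2\<^bsup>n\<^esup>\<close>, and likewise for \<open>\<pi> h\<close>. Hence an estimate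
  \<open>\<parallel>h\<^bsup>m\<^esup>\<parallel> \<le> C m \<parallel>\<pi> (h\<^bsup>m\<^esup>)\<parallel>\<close> with \<open>C\<close> independent of \<open>m\<close> already implies \<open>\<parallel>h\<parallel> \<le> \<parallel>\<pi> h\<parallel>\<close>: take
  \<open>m\<close>-th roots. So crude lower bounds for \<open>\<pi>\<close> suffice, as long as their constants grow at most linearly
  along powers. The trick is used twice.

  For the gauge-invariant part, consider the elements of degree \<open>0\<close>, that is, the span of
  the products \<open>s\<^sub>v p\<^sub>A s\<^sub>w\<^sup>*\<close> with words \<open>v\<close>, \<open>w\<close> of equal length. They are exhausted
  by the algebras \<open>core n\<close>, and \<open>norm_core_le\<close> treats these by induction on \<open>n\<close>. An element of
  \<open>core (n+1)\<close> has the form \<open>x = x\<^sub>0 + x'\<close>, with \<open>x\<^sub>0\<close> a combination of projections \<open>p\<^sub>A\<close> and with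
  \<open>q x' = x' = x' q\<close>, where \<open>q\<close> is the sum of \<open>s\<^sub>\<alpha> s\<^sub>\<alpha>\<^sup>*\<close> over a finite set \<open>F\<close> of labels. The corner
  \<open>q x q\<close> is controlled by the compressions \<open>s\<^sub>\<alpha>\<^sup>* x s\<^sub>\<beta>\<close>, which lie in \<open>core n\<close>.
  The rest, \<open>x\<^sub>0 (1 - q)\<close>, is a combination of orthogonal projections \<open>p\<^sub>A - p\<^sub>A q\<close>, and its
  coefficients can be read off \<open>\<pi> x\<close> unless \<open>\<pi>\<close> annihilates one of these projections that is nonzero. That does
  not happen (\<open>uncovered_faithful\<close>): if \<open>P\<^sub>A\<close> is covered by the ranges of the \<open>S\<^sub>\<alpha>\<close> with \<open>\<alpha>\<close> in \<open>F\<close>, then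
  \<open>A\<close> is regular because all \<open>P\<^sub>B\<close> with \<open>B \<noteq> \<emptyset>\<close> are nonzero, and the last Cuntz--Krieger relation
  makes \<open>p\<^sub>A\<close> covered as well. The resulting constant depends only on \<open>F\<close> and on the number of atoms
  needed to write down \<open>x\<^sub>0\<close>, so it is the same for all powers.

  For an element \<open>x = \<Sum> x\<^sub>k\<close> with components of degree \<open>-d \<le> k \<le> d\<close>, the action \<open>\<gamma>\<close> is by contractions, so the Fourier
  coefficients satisfy \<open>\<parallel>\<pi> x\<^sub>k\<parallel> \<le> \<parallel>\<pi> x\<parallel>\<close>; and \<open>\<parallel>x\<^sub>k\<parallel> \<le> \<parallel>\<pi> x\<^sub>k\<parallel>\<close> by the first part, because \<open>x\<^sub>k\<^sup>* x\<^sub>k\<close> has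
  degree \<open>0\<close>. Therefore \<open>\<parallel>x\<parallel> \<le> (2d + 1) \<parallel>\<pi> x\<parallel>\<close>, and passing to an \<open>m\<close>-th power replaces \<open>d\<close> by \<open>m d\<close> only.
  The power trick applies again, and such elements are dense.
\<close>

section \<open>Star-homomorphisms and the power trick\<close>

text \<open>
  All linear spans below are complex; they come from this instance.
\<close>

interpretation cvs: vector_space "scaleC :: complex \<Rightarrow> 'a::cstar_algebra \<Rightarrow> 'a"
  by unfold_locales (auto simp: scaleC_add_right scaleC_add_left scaleC_scaleC)

lemma star_zero [simp]: "star (0::'a::cstar_algebra) = 0"
  using star_add[of "0::'a" 0] by simp

lemma star_minus: "star (- x) = - star (x::'a::cstar_algebra)"
  using star_add[of x "-x"] by (simp add: eq_neg_iff_add_eq_0 add.commute)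

lemma star_diff: "star (x - y) = star x - star (y::'a::cstar_algebra)"
  using star_add[of x "-y"] by (simp add: star_minus)

lemma star_scaleR: "star (r *\<^sub>R x) = r *\<^sub>R star (x::'a::cstar_algebra)"
  by (simp add: scaleR_eq_scaleC star_scaleC)

lemma star_sum: "star (sum f A) = (\<Sum>i\<in>A. star (f i :: 'a::cstar_algebra))"
  by (induction A rule: infinite_finite_induct) (auto simp: star_add)

lemma norm_star [simp]: "norm (star x) = norm (x::'a::cstar_algebra)"
proof -
  have *: "norm y \<le> norm (star y)" for y :: 'a
  proof (cases "y = 0")
    case False
    have "norm y * norm y \<le> norm (star y) * norm y"
      using norm_mult_ineq[of "star y" y] by (simp add: cstar_identity power2_eq_square)
    with False show ?thesis by simp
  qed simp
  show ?thesis using *[of x] *[of "star x"] by (simp add: star_star)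
qed

lemma continuous_star: "continuous_on A (star :: 'a::cstar_algebra \<Rightarrow> 'a)"
proof -
  have "dist (star x) (star y) = dist x y" for x y :: 'a
    by (simp add: dist_norm flip: star_diff)
  then show ?thesis by (auto simp: continuous_on_iff)
qed

text \<open>
  The element \<open>y\<close> plays the role of \<open>1 - \<surd>(1 - h\<^sup>2)\<close>, which makes sense without a unit: the equation
  \<open>(1 - y)\<^sup>2 = 1 - h\<^sup>2\<close> reads \<open>y = (h\<^sup>2 + y\<^sup>2) / 2\<close>, and the right-hand side is a contraction
  on the ball of radius \<open>\<parallel>h\<^sup>2\<parallel> < 1\<close>.
\<close>

lemma subalgebra_sqrt:
  fixes h :: "'a::cstar_algebra"
  assumes X: "cstar_subalgebra X" and h: "h \<in> X" "star h = h" "norm h < 1"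
  obtains y where "y \<in> X" "star y = y" "y * h = h * y" "y + y = h * h + y * y"
proof -
  have add: "x + y \<in> X" and mult: "x * y \<in> X" if "x \<in> X" "y \<in> X" for x y
    using X that by (auto simp: cstar_subalgebra_def)
  have scl: "r *\<^sub>R x \<in> X" if "x \<in> X" for r x
    using X that by (auto simp: cstar_subalgebra_def scaleR_eq_scaleC)
  define \<rho> where "\<rho> = norm (h * h)"
  have "norm h * norm h < 1 * 1" using h(3) by (intro mult_strict_mono') auto
  then have \<rho>: "0 \<le> \<rho>" "\<rho> < 1" using norm_mult_ineq[of h h] by (auto simp: \<rho>_def)
  define T where "T y = (1/2::real) *\<^sub>R (h * h + y * y)" for y
  (* symmetry and commutation with h are closed conditions that T preserves,
     so the fixed point inherits them *)
  define Q where "Q = X \<inter> {y. star y = y} \<inter> {y. y * h = h * y} \<inter> cball 0 \<rho>"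
  have "closed Q"
    unfolding Q_def using X
    by (intro closed_Int closed_Collect_eq closed_cball continuous_star continuous_intros)
      (auto simp: cstar_subalgebra_def)
  then have "complete Q" by (simp add: complete_eq_closed)
  moreover have "0 \<in> Q" using X \<rho> by (auto simp: Q_def cstar_subalgebra_def)
  moreover have "T ` Q \<subseteq> Q"
  proof clarify
    fix y assume y: "y \<in> Q"
    have n: "norm (y * y) \<le> \<rho> * \<rho>"
      using y \<rho> by (intro order_trans[OF norm_mult_ineq] mult_mono) (auto simp: Q_def)
    have "\<rho> * \<rho> \<le> \<rho>" using \<rho> by (simp add: mult_left_le)
    then have "norm (T y) \<le> \<rho>"
      using n norm_triangle_ineq[of "h * h" "y * y"] unfolding T_def norm_scaleR \<rho>_def[symmetric] by simp
    moreover have "T y * h = h * T y"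
    proof -
      have yh: "y * h = h * y" using y by (simp add: Q_def)
      have "y * y * h = h * (y * y)" by (simp add: mult.assoc yh) (simp add: yh flip: mult.assoc)
      then show ?thesis by (simp add: T_def algebra_simps)
    qed
    ultimately show "T y \<in> Q"
      using y h by (auto simp: Q_def T_def star_scaleR star_add star_mult intro!: scl add mult)
  qed
  moreover have "dist (T x) (T y) \<le> \<rho> * dist x y" if "x \<in> Q" "y \<in> Q" for x y
  proof -
    have "T x - T y = (1/2::real) *\<^sub>R (x * (x - y) + (x - y) * y)"
      by (simp add: T_def algebra_simps flip: scaleR_diff_right)
    moreover have "norm (x * (x - y)) \<le> \<rho> * norm (x - y)"
      using that by (intro order_trans[OF norm_mult_ineq] mult_right_mono) (auto simp: Q_def)
    moreover have "norm ((x - y) * y) \<le> norm (x - y) * \<rho>"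
      using that by (intro order_trans[OF norm_mult_ineq] mult_left_mono) (auto simp: Q_def)
    moreover note norm_triangle_ineq[of "x * (x - y)" "(x - y) * y"]
    ultimately show ?thesis by (simp add: dist_norm mult.commute)
  qed
  ultimately have "\<exists>!y\<in>Q. T y = y"
    using \<rho> by (intro Banach_fix[of Q \<rho> T]) auto
  then obtain y where y: "y \<in> Q" "T y = y" by blast
  have "h * h + y * y = (2::real) *\<^sub>R T y" by (simp add: T_def)
  then have "y + y = h * h + y * y" using y by (simp add: scaleR_2)
  then show thesis using y that[of y] by (auto simp: Q_def)
qed

text \<open>
  With \<open>e = \<plusminus>\<i>\<close> the element acting on \<open>b\<close> is \<open>u = k + e (1 - w)\<close>. The hypotheses say that \<open>k\<close> and \<open>1 - w\<close>
  are commuting and self-adjoint with \<open>k\<^sup>2 + (1 - w)\<^sup>2 = 1\<close>, so \<open>u\<close> is unitary in the unitization. Left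
  multiplication expresses this inside the algebra itself.
\<close>

lemma norm_multiplier_isometry:
  fixes k w b :: "'a::cstar_algebra"
  assumes "star k = k" "star w = w" "w * k = k * w" "w + w = k * k + w * w"
    and e: "cnj e = - e" "cmod e = 1"
  shows "norm (k * b + e *\<^sub>C (b - w * b)) = norm b"
proof -
  have ee: "e * e = -1"
    using e complex_norm_square[of e] by (simp add: power2_eq_square)
      (metis minus_minus)
  define c where "c = b - w * b"
  have kw: "star c * (k * b) = star b * (k * c)"
    using assms by (simp add: c_def star_diff star_mult algebra_simps) (simp flip: mult.assoc)
  have cc: "star c * c = star b * b - star b * ((k * k) * b)"
  proof -
    have "star c * c = star b * b - star b * ((w + w) * b) + star b * ((w * w) * b)"
      using assms(2) by (simp add: c_def star_diff star_mult algebra_simps)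
    then show ?thesis unfolding assms(4) by (simp add: algebra_simps)
  qed
  have "star (k * b + e *\<^sub>C c) * (k * b + e *\<^sub>C c) = star b * ((k * k) * b) + star c * c"
    using assms ee kw
    by (simp add: star_add star_mult star_scaleC algebra_simps mult_scaleC_left mult_scaleC_right
        scaleC_scaleC scaleC_minus_one)
  then have "star (k * b + e *\<^sub>C c) * (k * b + e *\<^sub>C c) = star b * b" using cc by simp
  then have "(norm (k * b + e *\<^sub>C c))\<^sup>2 = (norm b)\<^sup>2" by (metis cstar_identity)
  then show ?thesis by (simp add: c_def)
qed

lemma star_hom_cstar_onD:
  assumes "star_hom (cstar_on X) (cstar_on Y) f"
  shows "\<And>x. x \<in> X \<Longrightarrow> f x \<in> Y"
    "\<And>x y. x \<in> X \<Longrightarrow> y \<in> X \<Longrightarrow> f (x + y) = f x + f y"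
    "\<And>x y. x \<in> X \<Longrightarrow> y \<in> X \<Longrightarrow> f (x * y) = f x * f y"
    "\<And>x a. x \<in> X \<Longrightarrow> f (a *\<^sub>C x) = a *\<^sub>C f x"
    "\<And>x. x \<in> X \<Longrightarrow> f (star x) = star (f x)"
  using assms by (auto simp: star_hom_def)

text \<open>
  A self-adjoint \<open>h\<close> with \<open>\<parallel>h\<parallel> < 1\<close> is the mean of the unitaries \<open>h \<plusminus> \<i> \<surd>(1 - h\<^sup>2)\<close>. A star-homomorphism
  preserves the algebraic identities that make them unitary, so \<open>f h\<close> is again a mean of two unitaries and
  has norm at most \<open>1\<close>. The general case follows by scaling and the C*-identity.
\<close>

lemma star_hom_contractive:
  assumes X: "cstar_subalgebra X" and f: "star_hom (cstar_on X) (cstar_on Y) f" and x: "x \<in> X"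
  shows "norm (f x) \<le> norm x"
proof -
  note hom = star_hom_cstar_onD[OF f]
  have closed: "0 \<in> X" "\<And>u v. u \<in> X \<Longrightarrow> v \<in> X \<Longrightarrow> u + v \<in> X \<and> u * v \<in> X"
      "\<And>u a. u \<in> X \<Longrightarrow> star u \<in> X \<and> a *\<^sub>C u \<in> X"
    using X by (auto simp: cstar_subalgebra_def)
  have unit_ball: "norm (f h) \<le> 1" if h: "h \<in> X" "star h = h" "norm h < 1" for h
  proof -
    obtain y where y: "y \<in> X" "star y = y" "y * h = h * y" "y + y = h * h + y * y"
      using subalgebra_sqrt[OF X h] .
    define k w where "k = f h" and "w = f y"
    have kw: "star k = k" "star w = w" "w * k = k * w" "w + w = k * k + w * w"
      using h(1,2) y hom(2)[of y y] hom(2)[of "h * h" "y * y"] hom(3)[of h y] hom(3)[of y h]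
        hom(3)[of h h] hom(3)[of y y] hom(5)[of h] hom(5)[of y] closed(2)
      by (simp_all add: k_def w_def)
    (* the two unitaries, applied to k itself *)
    let ?u = "\<lambda>e. k * k + e *\<^sub>C (k - w * k)"
    have "norm (?u \<i>) = norm k" "norm (?u (- \<i>)) = norm k"
      by (rule norm_multiplier_isometry; use kw in simp)+
    moreover have "?u \<i> + ?u (- \<i>) = (2::real) *\<^sub>R (k * k)"
      by (simp add: scaleR_2 cvs.scale_minus_left)
    ultimately have "norm (k * k) \<le> norm k"
      using norm_triangle_ineq[of "?u \<i>" "?u (- \<i>)"] by simp
    then have "norm k * norm k \<le> norm k * 1"
      using cstar_identity[of k] kw by (simp add: power2_eq_square)
    then show ?thesis
      unfolding k_def[symmetric]
      using mult_le_cancel_left_pos[of "norm k" "norm k" 1] by (cases "k = 0") auto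
  qed
  have selfadj: "norm (f h) \<le> norm h" if h: "h \<in> X" "star h = h" for h
  proof (rule dense_ge)
    fix r assume r: "norm h < r"
    then have "r > 0" using norm_ge_zero[of h] by linarith
    define g where "g = complex_of_real (1/r) *\<^sub>C h"
    have "g \<in> X" "star g = g" using h closed by (auto simp: g_def star_scaleC)
    moreover have "norm g < 1" using r \<open>r > 0\<close> by (simp add: g_def norm_scaleC norm_divide)
    ultimately have "norm (f g) \<le> 1" by (rule unit_ball)
    moreover have "f g = complex_of_real (1/r) *\<^sub>C f h" using hom h by (simp add: g_def)
    ultimately show "norm (f h) \<le> r" using \<open>r > 0\<close> by (simp add: norm_scaleC norm_divide)
  qed
  have "(norm (f x))\<^sup>2 = norm (f (star x * x))"
    using hom closed x by (simp add: cstar_identity)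
  also have "\<dots> \<le> norm (star x * x)"
    using closed x by (intro selfadj) (auto simp: star_mult star_star)
  finally show ?thesis by (simp add: cstar_identity power2_le_iff_abs_le)
qed

lemma cstar_subalgebra_UNIV: "cstar_subalgebra UNIV"
  by (simp add: cstar_subalgebra_def)

text \<open>
  This is \<open>x\<close> to the power \<open>2\<^bsup>n\<^esup>\<close>; the type class of C*-algebras has no unit, hence no powers. For a self-adjoint
  element these are exactly the powers whose norm the C*-identity computes.
\<close>

definition iter_square :: "nat \<Rightarrow> 'a::times \<Rightarrow> 'a" where
  "iter_square n = (\<lambda>x. x * x) ^^ n"

lemma iter_square_simps [simp]:
  "iter_square 0 x = x" "iter_square (Suc n) x = iter_square n x * iter_square n x"
  by (simp_all add: iter_square_def)

lemma star_iter_square: "star h = h \<Longrightarrow> star (iter_square n h) = iter_square n (h::'a::cstar_algebra)"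
  by (induction n) (auto simp: star_mult)

lemma norm_iter_square:
  "star h = h \<Longrightarrow> norm (iter_square n h) = norm (h::'a::cstar_algebra) ^ 2 ^ n"
proof (induction n)
  case (Suc n)
  then show ?case
    using cstar_identity[of "iter_square n h"] star_iter_square[of h n]
    by (simp add: mult.commute flip: power_mult)
qed simp

text \<open>
  If \<open>t < a\<close>, then \<open>m (t / a)\<^bsup>m\<^esup>\<close> tends to \<open>0\<close>, which contradicts the bound for large \<open>m = 2\<^bsup>n\<^esup>\<close>.
\<close>

lemma le_if_power_le_linear:
  fixes a t C :: real
  assumes "0 \<le> t" and bound: "\<And>n. a ^ 2 ^ n \<le> C * 2 ^ n * t ^ 2 ^ n"
  shows "a \<le> t"
proof (rule ccontr)
  assume "\<not> a \<le> t"
  then have a: "t < a" "0 < a" using assms by auto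
  define x where "x = t / a"
  have "norm x < 1" using a assms by (simp add: x_def)
  then have "(\<lambda>n. of_nat n * x ^ n) \<longlonglongrightarrow> 0" by (rule powser_times_n_limit_0)
  then have "(\<lambda>n. of_nat (2 ^ n) * x ^ (2 ^ n)) \<longlonglongrightarrow> 0"
    by (rule filterlim_compose) (rule filterlim_at_top_mono[OF filterlim_ident], auto simp: less_imp_le)
  then have "(\<lambda>n. C * (of_nat (2 ^ n) * x ^ (2 ^ n))) \<longlonglongrightarrow> C * 0"
    by (intro tendsto_intros)
  moreover have "1 \<le> C * (of_nat (2 ^ n) * x ^ (2 ^ n))" for n
    using bound[of n] a by (simp add: x_def power_divide field_simps)
  ultimately have "1 \<le> C * 0"
    by (intro tendsto_lowerbound[of _ _ sequentially]) auto
  then show False by simp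
qed

text \<open>
  The power trick: a factor that grows linearly in the exponent disappears on taking roots.
\<close>

lemma norm_le_if_powers_linear:
  fixes f :: "'a::cstar_algebra \<Rightarrow> 'd::cstar_algebra"
  assumes f: "star_hom cstar_univ cstar_univ f"
    and bound: "\<And>n. norm (iter_square n (star x * x)) \<le> C * 2 ^ n * norm (f (iter_square n (star x * x)))"
  shows "norm x \<le> norm (f x)"
proof -
  note hom = star_hom_cstar_onD[OF f]
  define h where "h = star x * x"
  have h: "star h = h" by (simp add: h_def star_mult star_star)
  have fh: "star (f h) = f h" using hom(5)[of h] h by simp
  have "f (iter_square n h) = iter_square n (f h)" for n
    by (induction n) (auto simp: hom)
  then have "norm h ^ 2 ^ n \<le> C * 2 ^ n * norm (f h) ^ 2 ^ n" for n
    using bound[of n] norm_iter_square[OF h, of n] norm_iter_square[OF fh, of n]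
    by (simp flip: h_def)
  then have "norm h \<le> norm (f h)" by (rule le_if_power_le_linear[OF norm_ge_zero])
  then show ?thesis
    by (simp add: h_def hom cstar_identity power2_le_iff_abs_le)
qed

section \<open>Spans and atoms\<close>

lemma span_mult:
  fixes x y :: "'a::cstar_algebra"
  assumes "x \<in> cvs.span A" "y \<in> cvs.span B"
    and gen: "\<And>a b. a \<in> A \<Longrightarrow> b \<in> B \<Longrightarrow> a * b \<in> cvs.span C"
  shows "x * y \<in> cvs.span C"
  using assms(1)
proof (induction rule: cvs.span_induct)
  case (step a)
  show ?case using assms(2)
    by (induction rule: cvs.span_induct)
      (auto simp: cvs.subspace_def distrib_left mult_scaleC_right gen[OF step]
        intro: cvs.span_add cvs.span_scale cvs.span_zero)
qed (auto simp: cvs.subspace_def distrib_right mult_scaleC_left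
    intro: cvs.span_add cvs.span_scale cvs.span_zero)

lemma span_star:
  fixes x :: "'a::cstar_algebra"
  assumes "x \<in> cvs.span A" and gen: "\<And>a. a \<in> A \<Longrightarrow> star a \<in> cvs.span C"
  shows "star x \<in> cvs.span C"
  using assms(1)
  by (induction rule: cvs.span_induct)
    (auto simp: cvs.subspace_def star_add star_scaleC gen
      intro: cvs.span_add cvs.span_scale cvs.span_zero)

lemma span_sandwich:
  fixes x :: "'a::cstar_algebra"
  assumes "x \<in> cvs.span A" and gen: "\<And>a. a \<in> A \<Longrightarrow> u * a * v \<in> cvs.span C"
  shows "u * x * v \<in> cvs.span C"
  using assms(1)
  by (induction rule: cvs.span_induct)
    (auto simp: cvs.subspace_def distrib_left distrib_right mult_scaleC_left mult_scaleC_right gen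
      intro: cvs.span_add cvs.span_scale cvs.span_zero)

lemma span_commute:
  fixes x :: "'a::cstar_algebra"
  assumes "x \<in> cvs.span A" and gen: "\<And>a. a \<in> A \<Longrightarrow> a * v = v * a"
  shows "x * v = v * x"
  using assms(1)
  by (induction rule: cvs.span_induct)
    (auto simp: cvs.subspace_def distrib_left distrib_right mult_scaleC_left mult_scaleC_right gen)

text \<open>
  The atoms of the Boolean algebra generated by a list, together with some entries \<open>\<bottom>\<close>. Distinct atoms may have
  the same meet \<open>\<bottom>\<close> with \<open>B\<close>; collecting them in a list makes sums over them split without a case
  distinction for these collisions.
\<close>

primrec atoms :: "'b::generalized_boolean_algebra list \<Rightarrow> 'b list" where
  "atoms [] = []"
| "atoms (B # Gs) = map (inf B) (atoms Gs) @ map (\<lambda>A. A - B) (atoms Gs) @ [B - foldr sup Gs bot]"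

lemma relative_compl_le: "A - B \<le> (A :: 'b::generalized_boolean_algebra)"
  using sup_relative_compl[of A B] by (metis sup_ge2)

lemma le_foldr_sup: "G \<in> set Gs \<Longrightarrow> (G::'b::generalized_boolean_algebra) \<le> foldr sup Gs bot"
  by (induction Gs) (auto intro: le_supI2)

lemma inf_bot_mono:
  "inf A G = bot \<Longrightarrow> A' \<le> A \<Longrightarrow> inf A' G = (bot :: 'b::generalized_boolean_algebra)"
  by (metis bot_unique inf_mono order_refl)

lemma atoms_separate:
  "A \<in> set (atoms Gs) \<Longrightarrow> G \<in> set Gs \<Longrightarrow> A \<le> G \<or> inf A G = (bot :: 'b::generalized_boolean_algebra)"
proof (induction Gs arbitrary: A G)
  case (Cons B Gs)
  let ?S = "foldr sup Gs bot"
  consider A' where "A' \<in> set (atoms Gs)" "A = inf B A'"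
    | A' where "A' \<in> set (atoms Gs)" "A = A' - B" | "A = B - ?S"
    using Cons.prems by auto
  then show ?case
  proof cases
    case 1
    then show ?thesis
      using Cons by (cases "G = B") (auto intro: le_infI2 inf_bot_mono[OF _ inf_le2])
  next
    case 2
    show ?thesis
    proof (cases "G = B")
      case True
      then show ?thesis using 2 inf_relative_compl[of B A'] by (simp add: inf.commute)
    next
      case False
      then have "A' \<le> G \<or> inf A' G = bot" using Cons 2 by auto
      then show ?thesis
        using relative_compl_le[of A' B] unfolding 2(2) by (meson order_trans inf_bot_mono)
    qed
  next
    case 3
    show ?thesis
    proof (cases "G = B")
      case True
      then show ?thesis using 3 relative_compl_le by blast
    next
      case False
      then have "G \<le> ?S" using Cons.prems le_foldr_sup by auto
      then have "inf G (B - ?S) = bot"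
        using inf_bot_mono inf_relative_compl by metis
      then show ?thesis using 3 by (simp add: inf.commute)
    qed
  qed
qed simp

section \<open>Cuntz--Krieger representations\<close>

locale cuntz_krieger =
  fixes L :: "'l set" and \<theta> :: "'l \<Rightarrow> 'b::generalized_boolean_algebra \<Rightarrow> 'b"
    and p :: "'b \<Rightarrow> 'u::cstar_algebra" and s :: "'l \<Rightarrow> 'u"
  assumes boolean_dynamical_system: "boolean_dynamical_system L \<theta>"
    and ck_representation: "ck_representation L \<theta> cstar_univ p s"
begin

lemma
  shows star_p: "star (p A) = p A"
    and p_mult: "p A * p B = p (inf A B)"
    and p_sup: "p (sup A B) = p A + p B - p (inf A B)"
    and p_bot: "p bot = 0"
    and p_s: "\<alpha> \<in> L \<Longrightarrow> p A * s \<alpha> = s \<alpha> * p (\<theta> \<alpha> A)"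
    and star_s_s: "\<alpha> \<in> L \<Longrightarrow> \<beta> \<in> L \<Longrightarrow> star (s \<alpha>) * s \<beta> = (if \<alpha> = \<beta> then p (range_top (\<theta> \<alpha>)) else 0)"
    and s_star_s: "\<alpha> \<in> L \<Longrightarrow> s \<alpha> * star (s \<alpha>) * s \<alpha> = s \<alpha>"
    and p_regular: "A \<in> regular_elements L \<theta> \<Longrightarrow>
      p A = (\<Sum>\<alpha>\<in>labels_of L \<theta> A. s \<alpha> * p (\<theta> \<alpha> A) * star (s \<alpha>))"
  using ck_representation
  by (auto simp: ck_representation_def projection_def partial_isometry_def)

lemma s_range_top: "\<alpha> \<in> L \<Longrightarrow> s \<alpha> * p (range_top (\<theta> \<alpha>)) = s \<alpha>"
  using s_star_s[of \<alpha>] star_s_s[of \<alpha> \<alpha>] by (simp add: mult.assoc)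

lemma le_range_top:
  assumes "\<alpha> \<in> L" shows "\<theta> \<alpha> A \<le> range_top (\<theta> \<alpha>)"
proof -
  have "compact_range (fold \<theta> [\<alpha>])"
    using boolean_dynamical_system assms unfolding boolean_dynamical_system_def
    by (metis empty_set insert_subset list.distinct(1) list.simps(15) empty_subsetI)
  then obtain R where R: "is_lub (range (\<theta> \<alpha>)) R" by (auto simp: compact_range_def)
  have "range_top (\<theta> \<alpha>) = R"
    unfolding range_top_def using R
    by (intro the_equality) (auto simp: is_lub_def intro: antisym)
  then show ?thesis using R by (auto simp: is_lub_def)
qed

text \<open>
  The Cuntz--Krieger relations give that \<open>s\<^sub>\<alpha>\<^sup>* p\<^sub>A s\<^sub>\<alpha>\<close> is \<open>p\<close> of the meet of \<open>\<theta>\<^sub>\<alpha> A\<close> with the top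
  of the range of \<open>\<theta>\<^sub>\<alpha>\<close>, and this top lies above \<open>\<theta>\<^sub>\<alpha> A\<close> because it is an upper bound.
\<close>

lemma star_s_p_s:
  assumes "\<alpha> \<in> L" "\<beta> \<in> L"
  shows "star (s \<alpha>) * p A * s \<beta> = (if \<alpha> = \<beta> then p (\<theta> \<alpha> A) else 0)"
proof -
  have "star (s \<alpha>) * p A * s \<beta> = star (s \<alpha>) * s \<beta> * p (\<theta> \<beta> A)"
    using assms by (simp add: mult.assoc p_s)
  then show ?thesis
    using assms le_range_top[of \<beta> A] by (simp add: star_s_s p_mult inf.absorb2)
qed

lemma p_disjoint_sup: "inf A B = bot \<Longrightarrow> p (sup A B) = p A + p B"
  by (simp add: p_sup p_bot)

lemma p_split: "p (inf B A) + p (A - B) = p A"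
proof -
  have "inf (inf A B) (A - B) = bot"
    by (metis inf_bot_mono inf_le2 inf_relative_compl)
  then show ?thesis
    using p_disjoint_sup[of "inf A B" "A - B"] sup_relative_compl[of A B] by (simp add: inf.commute)
qed

text \<open>
  The projection onto the joint range of the partial isometries with labels in \<open>F\<close>. It is the unit for
  everything of the form \<open>s\<^sub>\<alpha> y s\<^sub>\<beta>\<^sup>*\<close> with \<open>\<alpha>\<close>, \<open>\<beta>\<close> in \<open>F\<close>.
\<close>

definition cover :: "'l set \<Rightarrow> 'u" where
  "cover F = (\<Sum>\<alpha>\<in>F. s \<alpha> * star (s \<alpha>))"

lemma cover_s:
  assumes "finite F" "F \<subseteq> L" "\<alpha> \<in> L"
  shows "cover F * s \<alpha> = (if \<alpha> \<in> F then s \<alpha> else 0)"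
proof -
  have "cover F * s \<alpha> = (\<Sum>\<beta>\<in>F. if \<beta> = \<alpha> then s \<alpha> else 0)"
    unfolding cover_def sum_distrib_right
  proof (rule sum.cong)
    fix \<beta> assume "\<beta> \<in> F"
    with assms have "\<beta> \<in> L" by blast
    then show "s \<beta> * star (s \<beta>) * s \<alpha> = (if \<beta> = \<alpha> then s \<alpha> else 0)"
      using assms by (simp add: mult.assoc star_s_s s_range_top)
  qed simp
  then show ?thesis using assms by simp
qed

lemma star_cover: "star (cover F) = cover F"
  by (simp add: cover_def star_sum star_mult star_star)

lemma star_s_cover:
  assumes "finite F" "F \<subseteq> L" "\<alpha> \<in> L"
  shows "star (s \<alpha>) * cover F = (if \<alpha> \<in> F then star (s \<alpha>) else 0)"
  using arg_cong[OF cover_s[OF assms], of star] by (simp add: star_mult star_cover split: if_splits)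

lemma cover_cover:
  assumes "finite G" "F \<subseteq> G" "G \<subseteq> L"
  shows "cover G * cover F = cover F" "cover F * cover G = cover F"
proof -
  show "cover G * cover F = cover F"
    unfolding cover_def[of F] sum_distrib_left
    by (rule sum.cong) (use assms in \<open>auto simp: cover_s subset_iff simp flip: mult.assoc\<close>)
  then show "cover F * cover G = cover F"
    by (metis star_mult star_cover)
qed

lemma p_mult_cover:
  assumes "F \<subseteq> L"
  shows "p A * cover F = (\<Sum>\<alpha>\<in>F. s \<alpha> * p (\<theta> \<alpha> A) * star (s \<alpha>))"
  unfolding cover_def sum_distrib_left
  by (rule sum.cong) (use assms in \<open>auto simp: p_s subset_iff simp flip: mult.assoc\<close>)

lemma p_cover_commute: "F \<subseteq> L \<Longrightarrow> p A * cover F = cover F * p A"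
proof -
  assume F: "F \<subseteq> L"
  then have "star (p A * cover F) = p A * cover F"
    by (simp add: p_mult_cover star_sum star_mult star_star star_p mult.assoc)
  then show ?thesis by (simp add: star_mult star_cover star_p)
qed

lemma covered_if_regular:
  assumes "A \<in> regular_elements L \<theta>" "labels_of L \<theta> A \<subseteq> F" "finite F" "F \<subseteq> L"
  shows "p A * cover F = p A"
proof -
  have "p A * cover F = (\<Sum>\<alpha>\<in>labels_of L \<theta> A. s \<alpha> * p (\<theta> \<alpha> A) * star (s \<alpha>))"
    unfolding p_mult_cover[OF assms(4)]
    by (rule sum.mono_neutral_right) (use assms in \<open>auto simp: labels_of_def p_bot\<close>)
  also have "\<dots> = p A" by (rule p_regular[OF assms(1), symmetric])
  finally show ?thesis .
qed

text \<open>
  In a faithful representation, a projection \<open>p\<^sub>A\<close> is covered by finitely many labels only if the relation for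
  regular elements forces it to be. For \<open>B \<le> A\<close> and a label \<open>\<alpha>\<close> outside
  \<open>F\<close>, covering gives \<open>p (\<theta> \<alpha> B) = s\<^sub>\<alpha>\<^sup>* p\<^sub>B q s\<^sub>\<alpha> = 0\<close>, where \<open>q\<close> is the cover, hence \<open>\<theta> \<alpha> B = \<bottom>\<close>. If no
  label survived on \<open>B \<noteq> \<bottom>\<close>, then \<open>p\<^sub>B = p\<^sub>B q = 0\<close>. The conclusion does not mention the representation,
  so it carries the covering over to any other one.
\<close>

lemma regular_if_covered:
  assumes faithful: "\<And>A. A \<noteq> bot \<Longrightarrow> p A \<noteq> 0"
    and F: "finite F" "F \<subseteq> L" and A: "p A * cover F = p A"
  shows "A \<in> regular_elements L \<theta>" "labels_of L \<theta> A \<subseteq> F"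
proof -
  have cov: "p B * cover F = p B" if "B \<le> A" for B
  proof -
    have "p B = p B * p A" using that by (simp add: p_mult inf.absorb1)
    then show ?thesis using A by (metis mult.assoc)
  qed
  have sub: "labels_of L \<theta> B \<subseteq> F" if "B \<le> A" for B
  proof (rule subsetI, rule ccontr)
    fix \<alpha> assume \<alpha>: "\<alpha> \<in> labels_of L \<theta> B" "\<alpha> \<notin> F"
    then have "\<alpha> \<in> L" "\<theta> \<alpha> B \<noteq> bot" by (auto simp: labels_of_def)
    have "p (\<theta> \<alpha> B) = star (s \<alpha>) * (p B * cover F) * s \<alpha>"
      using star_s_p_s[of \<alpha> \<alpha> B] \<open>\<alpha> \<in> L\<close> by (simp add: cov[OF that])
    also have "\<dots> = 0" using \<alpha> \<open>\<alpha> \<in> L\<close> F by (simp add: mult.assoc cover_s)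
    finally show False using faithful \<open>\<theta> \<alpha> B \<noteq> bot\<close> by blast
  qed
  have "labels_of L \<theta> B \<noteq> {}" if "B \<le> A" "B \<noteq> bot" for B
  proof
    assume "labels_of L \<theta> B = {}"
    then have "\<theta> \<alpha> B = bot" if "\<alpha> \<in> F" for \<alpha> using F that by (auto simp: labels_of_def)
    then have "p B * cover F = 0" using F by (simp add: p_mult_cover p_bot)
    then show False using cov[OF that(1)] faithful[OF that(2)] by simp
  qed
  then show "A \<in> regular_elements L \<theta>"
    using sub F by (auto simp: regular_elements_def card_gt_0_iff intro: finite_subset)
  show "labels_of L \<theta> A \<subseteq> F" by (rule sub) simp
qed

section \<open>The gauge-invariant core\<close>

definition sandwiches :: "'u set \<Rightarrow> 'u set" where
  "sandwiches X = {s \<alpha> * x * star (s \<beta>) | \<alpha> \<beta> x. \<alpha> \<in> L \<and> \<beta> \<in> L \<and> x \<in> X}"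

lemma sandwichesI: "\<alpha> \<in> L \<Longrightarrow> \<beta> \<in> L \<Longrightarrow> x \<in> X \<Longrightarrow> s \<alpha> * x * star (s \<beta>) \<in> sandwiches X"
  by (auto simp: sandwiches_def)

lemma sandwichesE:
  assumes "a \<in> sandwiches X"
  obtains \<alpha> \<beta> x where "a = s \<alpha> * x * star (s \<beta>)" "\<alpha> \<in> L" "\<beta> \<in> L" "x \<in> X"
  using assms by (auto simp: sandwiches_def)

text \<open>
  This is the span of all \<open>s\<^sub>v p\<^sub>A s\<^sub>w\<^sup>*\<close> with words \<open>v\<close>, \<open>w\<close> of equal length at most \<open>n\<close>. Peeling
  off the outermost labels matches the induction below and makes words unnecessary.
\<close>

primrec core :: "nat \<Rightarrow> 'u set" where
  "core 0 = cvs.span (range p)"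
| "core (Suc n) = cvs.span (range p \<union> sandwiches (core n))"

lemma subspace_core: "cvs.subspace (core n)"
  by (cases n) auto

lemma zero_in_core: "0 \<in> core n"
  using subspace_core by (rule cvs.subspace_0)

lemma p_in_core: "p A \<in> core n"
  by (cases n) (auto intro: cvs.span_base)

lemma sandwich_in_core:
  "\<alpha> \<in> L \<Longrightarrow> \<beta> \<in> L \<Longrightarrow> x \<in> core n \<Longrightarrow> s \<alpha> * x * star (s \<beta>) \<in> core (Suc n)"
  by (auto intro: cvs.span_base sandwichesI)

lemma core_mono_Suc: "core n \<subseteq> core (Suc n)"
proof (induction n)
  case (Suc n)
  then have "sandwiches (core n) \<subseteq> sandwiches (core (Suc n))"
    unfolding sandwiches_def by blast
  then show ?case unfolding core.simps by (intro cvs.span_mono) blast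
qed (auto intro!: cvs.span_mono)

lemma core_mono: "m \<le> n \<Longrightarrow> core m \<subseteq> core n"
  by (rule lift_Suc_mono_le[of core]) (rule core_mono_Suc)

lemma star_in_core: "x \<in> core n \<Longrightarrow> star x \<in> core n"
proof (induction n arbitrary: x)
  case 0
  then show ?case unfolding core.simps
    by (rule span_star) (auto simp: star_p intro: cvs.span_base)
next
  case (Suc n)
  have "star a \<in> core (Suc n)" if "a \<in> range p \<union> sandwiches (core n)" for a
    using that
  proof
    assume "a \<in> sandwiches (core n)"
    then obtain \<alpha> \<beta> y where "a = s \<alpha> * y * star (s \<beta>)" "\<alpha> \<in> L" "\<beta> \<in> L" "y \<in> core n"
      by (rule sandwichesE)
    then have "star a = s \<beta> * star y * star (s \<alpha>)" "\<alpha> \<in> L" "\<beta> \<in> L" "star y \<in> core n"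
      using Suc.IH by (auto simp: star_mult star_star mult.assoc)
    then show ?thesis using sandwich_in_core by metis
  qed (use p_in_core[of _ "Suc n"] star_p in \<open>auto simp del: core.simps\<close>)
  then show ?case
    using Suc.prems span_star[of x "range p \<union> sandwiches (core n)" "range p \<union> sandwiches (core n)"]
    by simp
qed

lemma p_mult_core: "x \<in> core n \<Longrightarrow> p A * x \<in> core n"
proof (induction n arbitrary: x A)
  case 0
  have "p A \<in> cvs.span {p A}" by (rule cvs.span_base) simp
  then show ?case unfolding core.simps
    by (rule span_mult[OF _ 0[unfolded core.simps]]) (auto simp: p_mult intro!: cvs.span_base)
next
  case (Suc n)
  have gen: "p A * a \<in> core (Suc n)" if "a \<in> range p \<union> sandwiches (core n)" for a
    using that
  proof
    assume "a \<in> sandwiches (core n)"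
    then obtain \<alpha> \<beta> y where a: "a = s \<alpha> * y * star (s \<beta>)" "\<alpha> \<in> L" "\<beta> \<in> L" "y \<in> core n"
      by (rule sandwichesE)
    then have "p A * a = s \<alpha> * (p (\<theta> \<alpha> A) * y) * star (s \<beta>)"
      by (simp add: p_s flip: mult.assoc)
    then show ?thesis using a Suc.IH sandwich_in_core by metis
  qed (use p_in_core[of _ "Suc n"] p_mult in \<open>auto simp del: core.simps\<close>)
  have "p A \<in> cvs.span {p A}" by (rule cvs.span_base) simp
  then show ?case unfolding core.simps
    by (rule span_mult[OF _ Suc.prems[unfolded core.simps]]) (use gen in simp)
qed

lemma core_mult_p:
  assumes "x \<in> core n" shows "x * p A \<in> core n"
proof -
  have "star (p A * star x) \<in> core n" by (intro star_in_core p_mult_core assms)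
  then show ?thesis by (simp only: star_mult star_star star_p)
qed

lemma core_mult: "x \<in> core n \<Longrightarrow> y \<in> core n \<Longrightarrow> x * y \<in> core n"
proof (induction n arbitrary: x y)
  case 0
  have "a * b \<in> cvs.span (range p)" if "a \<in> range p" "b \<in> range p" for a b
    using that p_mult by (intro cvs.span_base) auto
  then show ?case using span_mult[of x "range p" y "range p" "range p"] 0 by simp
next
  case (Suc n)
  let ?G = "range p \<union> sandwiches (core n)"
  have G: "a * b \<in> core (Suc n)" if ab: "a \<in> ?G" "b \<in> ?G" for a b
  proof -
    have core: "a \<in> core (Suc n)" "b \<in> core (Suc n)" using ab by (auto intro: cvs.span_base)
    consider A where "a = p A" | A where "b = p A"
      | "a \<in> sandwiches (core n)" "b \<in> sandwiches (core n)"
      using ab by auto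
    then show ?thesis
    proof cases
      case 1
      then show ?thesis using p_mult_core[OF core(2)] by (simp only:)
    next
      case 2
      then show ?thesis using core_mult_p[OF core(1)] by (simp only:)
    next
      case 3
      from 3(1) obtain \<alpha> \<beta> x where a: "a = s \<alpha> * x * star (s \<beta>)" "\<alpha> \<in> L" "\<beta> \<in> L" "x \<in> core n"
        by (rule sandwichesE)
      from 3(2) obtain \<gamma> \<delta> y where b: "b = s \<gamma> * y * star (s \<delta>)" "\<gamma> \<in> L" "\<delta> \<in> L" "y \<in> core n"
        by (rule sandwichesE)
      have "a * b = s \<alpha> * (x * ((star (s \<beta>) * s \<gamma>) * y)) * star (s \<delta>)"
        by (simp add: a b mult.assoc)
      moreover have "x * ((star (s \<beta>) * s \<gamma>) * y) \<in> core n"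
        using a b Suc.IH[OF a(4) p_mult_core[OF b(4)]] zero_in_core by (simp add: star_s_s)
      ultimately show ?thesis using a b sandwich_in_core by metis
    qed
  qed
  show ?case using span_mult[of x ?G y ?G ?G] Suc.prems G by simp
qed

text \<open>
  Compression by \<open>s\<^sub>\<alpha>\<close> and \<open>s\<^sub>\<beta>\<close> strips one layer; this is what lowers \<open>n\<close> in the induction.
\<close>

lemma core_compress:
  assumes "x \<in> core (Suc n)" and L: "\<alpha> \<in> L" "\<beta> \<in> L"
  shows "star (s \<alpha>) * x * s \<beta> \<in> core n"
proof -
  have "star (s \<alpha>) * x * s \<beta> \<in> cvs.span (core n)"
    using assms(1) unfolding core.simps
  proof (rule span_sandwich)
    fix a assume "a \<in> range p \<union> sandwiches (core n)"
    then consider A where "a = p A"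
      | \<gamma> \<delta> y where "a = s \<gamma> * y * star (s \<delta>)" "\<gamma> \<in> L" "\<delta> \<in> L" "y \<in> core n"
      by (auto elim: sandwichesE)
    then have "star (s \<alpha>) * a * s \<beta> \<in> core n"
    proof cases
      case 1
      then show ?thesis
        using L p_in_core zero_in_core by (simp add: star_s_p_s)
    next
      case 2
      have "star (s \<alpha>) * a * s \<beta> = (star (s \<alpha>) * s \<gamma>) * y * (star (s \<delta>) * s \<beta>)"
        by (simp add: 2 mult.assoc)
      then show ?thesis
        using L 2 p_mult_core core_mult_p zero_in_core by (simp add: star_s_s)
    qed
    then show "star (s \<alpha>) * a * s \<beta> \<in> cvs.span (core n)" by (rule cvs.span_base)
  qed
  then show ?thesis using cvs.span_eq_iff subspace_core by metis
qed

text \<open>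
  A generator \<open>s\<^sub>\<alpha> y s\<^sub>\<beta>\<^sup>*\<close> is fixed by the cover of \<open>{\<alpha>, \<beta>}\<close> and hence by every larger cover, so one finite
  set of labels serves all summands.
\<close>

lemma core_decompose:
  assumes "x \<in> core (Suc n)"
  shows "\<exists>x0 x' F. x = x0 + x' \<and> x0 \<in> cvs.span (range p) \<and> finite F \<and> F \<subseteq> L \<and>
    cover F * x' = x' \<and> x' * cover F = x'"
  using assms unfolding core.simps
proof (induction rule: cvs.span_induct)
  case (step a)
  then consider A where "a = p A" | \<alpha> \<beta> y where "a = s \<alpha> * y * star (s \<beta>)" "\<alpha> \<in> L" "\<beta> \<in> L"
    by (auto elim: sandwichesE)
  then show ?case
  proof cases
    case 1
    show ?thesis
      by (rule exI[of _ a], rule exI[of _ 0], rule exI[of _ "{}"]) (auto simp: 1 intro: cvs.span_base)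
  next
    case 2
    have "cover {\<alpha>, \<beta>} * a = a" "a * cover {\<alpha>, \<beta>} = a"
      using 2 cover_s[of "{\<alpha>, \<beta>}" \<alpha>] star_s_cover[of "{\<alpha>, \<beta>}" \<beta>]
      by (simp_all add: mult.assoc) (simp flip: mult.assoc)
    then show ?thesis
      using 2 by (intro exI[of _ 0] exI[of _ a] exI[of _ "{\<alpha>, \<beta>}"]) (auto intro: cvs.span_zero)
  qed
next
  case base
  show ?case
    unfolding cvs.subspace_def mem_Collect_eq
  proof (intro conjI ballI allI; (elim CollectE exE conjE)?)
    show "\<exists>x0 x' F. 0 = x0 + x' \<and> x0 \<in> cvs.span (range p) \<and> finite F \<and> F \<subseteq> L \<and>
      cover F * x' = x' \<and> x' * cover F = x'"
      by (intro exI[of _ 0] exI[of _ "{}"]) (auto intro: cvs.span_zero)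
  next
    fix x y x0 x' F y0 y' G
    assume x: "x = x0 + x'" "x0 \<in> cvs.span (range p)" "finite F" "F \<subseteq> L"
        "cover F * x' = x'" "x' * cover F = x'"
      and y: "y = y0 + y'" "y0 \<in> cvs.span (range p)" "finite G" "G \<subseteq> L"
        "cover G * y' = y'" "y' * cover G = y'"
    have "cover (F \<union> G) * x' = x'" "x' * cover (F \<union> G) = x'"
      using x y cover_cover[of "F \<union> G" F] by (metis Un_least finite_Un mult.assoc sup_ge1)+
    moreover have "cover (F \<union> G) * y' = y'" "y' * cover (F \<union> G) = y'"
      using x y cover_cover[of "F \<union> G" G] by (metis Un_least finite_Un mult.assoc sup_ge2)+
    ultimately show "\<exists>x0 x' F. x + y = x0 + x' \<and> x0 \<in> cvs.span (range p) \<and> finite F \<and> F \<subseteq> L \<and>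
      cover F * x' = x' \<and> x' * cover F = x'"
      using x y
      by (intro exI[of _ "x0 + y0"] exI[of _ "x' + y'"] exI[of _ "F \<union> G"])
        (auto simp: algebra_simps intro: cvs.span_add)
  next
    fix c x x0 x' F
    assume x: "x = x0 + x'" "x0 \<in> cvs.span (range p)" "finite F" "F \<subseteq> L"
        "cover F * x' = x'" "x' * cover F = x'"
    then show "\<exists>x0 x' F. c *\<^sub>C x = x0 + x' \<and> x0 \<in> cvs.span (range p) \<and> finite F \<and> F \<subseteq> L \<and>
      cover F * x' = x' \<and> x' * cover F = x'"
      by (intro exI[of _ "c *\<^sub>C x0"] exI[of _ "c *\<^sub>C x'"] exI[of _ F])
        (auto simp: scaleC_add_right mult_scaleC_left mult_scaleC_right intro: cvs.span_scale)
  qed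
qed

text \<open>
  The atoms of a list add up to the projection of its join: meeting with \<open>B\<close> and subtracting \<open>B\<close> splits
  every old atom, and the part of \<open>B\<close> outside the old join is added.
\<close>

lemma sum_p_atoms: "sum_list (map p (atoms Gs)) = p (foldr sup Gs bot)"
proof (induction Gs)
  case (Cons B Gs)
  let ?S = "foldr sup Gs bot"
  have "sum_list (map p (map (inf B) As)) + sum_list (map p (map (\<lambda>A. A - B) As)) = sum_list (map p As)"
    for As
    by (induction As) (use p_split in \<open>auto simp: algebra_simps\<close>)
  then have "sum_list (map p (atoms (B # Gs))) = p ?S + p (B - ?S)"
    using Cons by (simp add: algebra_simps)
  also have "\<dots> = p (sup ?S (B - ?S))"
    by (rule p_disjoint_sup[symmetric]) (rule inf_relative_compl)
  also have "sup ?S (B - ?S) = sup (sup ?S (inf B ?S)) (B - ?S)"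
    by (simp add: sup.absorb1)
  also have "\<dots> = sup ?S B"
    by (simp only: sup.assoc sup_relative_compl)
  finally show ?case by (simp add: sup.commute)
qed (simp add: p_bot)

text \<open>
  A combination of projections \<open>p\<^sub>A\<close> is diagonal with respect to the atoms of the elements that occur in it. The
  conclusion is phrased by eigenvalue equations, not by coefficients, because these pass directly to products and
  adjoints; the equation with \<open>E\<close>, the join of the atoms, says that the atoms exhaust \<open>x\<close>.
\<close>

lemma diagonalize:
  assumes "x \<in> cvs.span (range p)"
  obtains As E where "\<And>A. A \<in> set As \<Longrightarrow> \<exists>c. x * p A = c *\<^sub>C p A"
    "sum_list (map p As) = p E" "x * p E = x"
proof -
  have "\<exists>Gs. x \<in> cvs.span (p ` set Gs)"
    using assms
  proof (induction rule: cvs.span_induct)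
    case (step a)
    then obtain A where "a = p A" by blast
    then show ?case by (intro exI[of _ "[A]"]) (auto intro: cvs.span_base)
  next
    case base
    have "x + y \<in> cvs.span (p ` set (Gs @ Hs))"
      if "x \<in> cvs.span (p ` set Gs)" "y \<in> cvs.span (p ` set Hs)" for x y Gs Hs
    proof -
      have "cvs.span (p ` set Gs) \<subseteq> cvs.span (p ` set (Gs @ Hs))"
        "cvs.span (p ` set Hs) \<subseteq> cvs.span (p ` set (Gs @ Hs))"
        by (rule cvs.span_mono; auto)+
      then show ?thesis using that by (blast intro: cvs.span_add)
    qed
    then show ?case
      unfolding cvs.subspace_def by (blast intro: cvs.span_zero cvs.span_scale)
  qed
  then obtain Gs where Gs: "x \<in> cvs.span (p ` set Gs)" ..
  show thesis
  proof
    fix A assume A: "A \<in> set (atoms Gs)"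
    show "\<exists>c. x * p A = c *\<^sub>C p A"
      using Gs
    proof (induction rule: cvs.span_induct)
      case (step a)
      then obtain G where G: "G \<in> set Gs" "a = p G" by blast
      then have "a * p A = p A \<or> a * p A = 0"
        using atoms_separate[OF A G(1)] by (auto simp: p_mult p_bot inf.commute inf.absorb1)
      then show ?case by (metis scaleC_one cvs.scale_zero_left)
    next
      case base
      show ?case
        unfolding cvs.subspace_def mem_Collect_eq
      proof (intro conjI ballI allI)
        show "\<exists>c. 0 * p A = c *\<^sub>C p A" by (rule exI[of _ 0]) simp
      next
        fix y z assume "y \<in> {x. \<exists>c. x * p A = c *\<^sub>C p A}" "z \<in> {x. \<exists>c. x * p A = c *\<^sub>C p A}"
        then obtain c d where "y * p A = c *\<^sub>C p A" "z * p A = d *\<^sub>C p A" by blast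
        then have "(y + z) * p A = (c + d) *\<^sub>C p A" by (simp add: distrib_right scaleC_add_left)
        then show "\<exists>c. (y + z) * p A = c *\<^sub>C p A" ..
      qed (auto simp: mult_scaleC_left scaleC_scaleC)
    qed
  next
    show "sum_list (map p (atoms Gs)) = p (foldr sup Gs bot)" by (rule sum_p_atoms)
    show "x * p (foldr sup Gs bot) = x"
      using Gs
      by (induction rule: cvs.span_induct)
        (auto simp: cvs.subspace_def distrib_right mult_scaleC_left p_mult inf.absorb1 le_foldr_sup)
  qed
qed

end

lemma norm_projection:
  fixes x :: "'a::cstar_algebra"
  assumes "star x = x" "x * x = x" "x \<noteq> 0"
  shows "norm x = 1"
  using cstar_identity[of x] assms by (simp add: power2_eq_square)

lemma norm_projection_le:
  "star x = x \<Longrightarrow> x * x = x \<Longrightarrow> norm (x::'a::cstar_algebra) \<le> 1"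
  using norm_projection[of x] by (cases "x = 0") auto

lemma norm_mult3: "norm (a * b * c) \<le> norm a * norm b * norm (c::'a::real_normed_algebra)"
  by (rule order_trans[OF norm_mult_ineq mult_right_mono[OF norm_mult_ineq norm_ge_zero]])

context cuntz_krieger begin

lemma norm_p_le: "norm (p A) \<le> 1"
  by (rule norm_projection_le) (auto simp: star_p p_mult)

lemma norm_s_le: "\<alpha> \<in> L \<Longrightarrow> norm (s \<alpha>) \<le> 1"
  using cstar_identity[of "s \<alpha>"] norm_p_le[of "range_top (\<theta> \<alpha>)"]
  by (simp add: star_s_s power2_le_iff_abs_le[of 1, simplified])

lemma norm_sandwich_le: "\<alpha> \<in> L \<Longrightarrow> \<beta> \<in> L \<Longrightarrow> norm (s \<alpha> * x * star (s \<beta>)) \<le> norm x"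
proof -
  assume L: "\<alpha> \<in> L" "\<beta> \<in> L"
  have "norm (s \<alpha> * x * star (s \<beta>)) \<le> norm (s \<alpha>) * norm x * norm (s \<beta>)"
    using norm_mult3[of "s \<alpha>" x "star (s \<beta>)"] norm_mult3[of "star (s \<alpha>)" x "s \<beta>"] by simp
  also have "\<dots> \<le> 1 * norm x * 1"
    using L norm_s_le by (intro mult_mono) auto
  finally show ?thesis by simp
qed

lemma norm_compress_le: "\<alpha> \<in> L \<Longrightarrow> \<beta> \<in> L \<Longrightarrow> norm (star (s \<alpha>) * x * s \<beta>) \<le> norm x"
proof -
  assume L: "\<alpha> \<in> L" "\<beta> \<in> L"
  have "norm (star (s \<alpha>) * x * s \<beta>) \<le> norm (s \<alpha>) * norm x * norm (s \<beta>)"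
    using norm_mult3[of "s \<alpha>" x "star (s \<beta>)"] norm_mult3[of "star (s \<alpha>)" x "s \<beta>"] by simp
  also have "\<dots> \<le> 1 * norm x * 1"
    using L norm_s_le by (intro mult_mono) auto
  finally show ?thesis by simp
qed

lemma cover_compress:
  "cover F * x * cover F = (\<Sum>\<alpha>\<in>F. \<Sum>\<beta>\<in>F. s \<alpha> * (star (s \<alpha>) * x * s \<beta>) * star (s \<beta>))"
  by (simp add: cover_def sum_distrib_left sum_distrib_right mult.assoc) (rule sum.swap)

end

section \<open>Lower bounds on the core\<close>

locale ck_morphism =
  dom: cuntz_krieger L \<theta> p s + cod: cuntz_krieger L \<theta> P S
  for L :: "'l set" and \<theta> :: "'l \<Rightarrow> 'b::generalized_boolean_algebra \<Rightarrow> 'b"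
    and p :: "'b \<Rightarrow> 'u::cstar_algebra" and s :: "'l \<Rightarrow> 'u"
    and P :: "'b \<Rightarrow> 'a::cstar_algebra" and S :: "'l \<Rightarrow> 'a" +
  fixes \<pi> :: "'u \<Rightarrow> 'a"
  assumes star_hom: "star_hom cstar_univ cstar_univ \<pi>"
    and \<pi>_p: "\<pi> (p A) = P A"
    and \<pi>_s: "\<alpha> \<in> L \<Longrightarrow> \<pi> (s \<alpha>) = S \<alpha>"
    and faithful: "A \<noteq> bot \<Longrightarrow> P A \<noteq> 0"
begin

lemma
  shows \<pi>_add: "\<pi> (x + y) = \<pi> x + \<pi> y"
    and \<pi>_mult: "\<pi> (x * y) = \<pi> x * \<pi> y"
    and \<pi>_scaleC: "\<pi> (c *\<^sub>C x) = c *\<^sub>C \<pi> x"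
    and \<pi>_star: "\<pi> (star x) = star (\<pi> x)"
  using star_hom_cstar_onD[OF star_hom] by auto

lemma \<pi>_zero: "\<pi> 0 = 0"
  using \<pi>_scaleC[of 0 0] by simp

lemma \<pi>_diff: "\<pi> (x - y) = \<pi> x - \<pi> y"
  using \<pi>_add[of "x - y" y] by simp

lemma \<pi>_sum: "\<pi> (sum f A) = (\<Sum>i\<in>A. \<pi> (f i))"
  by (induction A rule: infinite_finite_induct) (auto simp: \<pi>_add \<pi>_zero)

lemma \<pi>_cover: "F \<subseteq> L \<Longrightarrow> \<pi> (dom.cover F) = cod.cover F"
  unfolding dom.cover_def cod.cover_def \<pi>_sum
  by (rule sum.cong) (auto simp: \<pi>_mult \<pi>_star \<pi>_s)

lemma norm_\<pi>_le: "norm (\<pi> x) \<le> norm x"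
  by (rule star_hom_contractive[OF cstar_subalgebra_UNIV star_hom]) simp

lemma uncovered_faithful:
  assumes F: "finite F" "F \<subseteq> L" and ne: "p A - p A * dom.cover F \<noteq> 0"
  shows "\<pi> (p A - p A * dom.cover F) \<noteq> 0"
proof
  assume "\<pi> (p A - p A * dom.cover F) = 0"
  then have "P A * cod.cover F = P A" using F by (simp add: \<pi>_diff \<pi>_mult \<pi>_p \<pi>_cover)
  then have "A \<in> regular_elements L \<theta>" "labels_of L \<theta> A \<subseteq> F"
    using cod.regular_if_covered[OF faithful F] by auto
  then have "p A * dom.cover F = p A" using F by (rule dom.covered_if_regular)
  with ne show False by simp
qed

text \<open>
  The projection \<open>r = p\<^sub>A - p\<^sub>A q\<close> annihilates \<open>x'\<close> and is an eigenprojection of \<open>x\<^sub>0\<close>, so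
  \<open>r x r = c r\<close>. Its image has norm \<open>1\<close> unless \<open>r = 0\<close>, so \<open>\<bar>c\<bar>\<close> is the norm of a corner of \<open>\<pi> x\<close>.
\<close>

lemma uncovered_corner_le:
  assumes F: "finite F" "F \<subseteq> L"
    and x0: "x0 \<in> cvs.span (range p)" "x0 * p A = c *\<^sub>C p A" and x': "dom.cover F * x' = x'"
  shows "norm (x0 * p A - x0 * p A * dom.cover F) \<le> norm (\<pi> (x0 + x'))"
proof -
  let ?q = "dom.cover F"
  define r where "r = p A - p A * ?q"
  have qq: "?q * ?q = ?q" using dom.cover_cover[of F F] F by simp
  have comm: "?q * p A = p A * ?q" using dom.p_cover_commute F by simp
  have pq: "p A * (p A * ?q) = p A * ?q" by (simp add: dom.p_mult flip: mult.assoc)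
  have qp: "?q * (p A * ?q) = p A * ?q" using comm qq by (metis mult.assoc)
  have rq: "r * ?q = 0" by (simp add: r_def algebra_simps qq)
  have star_r: "star r = r" by (simp add: r_def star_diff star_mult dom.star_p dom.star_cover comm)
  have rr: "r * r = r" using pq qp comm by (simp add: r_def algebra_simps dom.p_mult)
  have x0r: "x0 * r = c *\<^sub>C r"
    by (simp add: r_def right_diff_distrib x0 mult_scaleC_left cvs.scale_right_diff_distrib
        flip: mult.assoc)
  have "r * (x0 + x') * r = r * (x0 * r) + (r * ?q) * x' * r"
    by (simp add: distrib_left distrib_right mult.assoc x')
  then have rxr: "r * (x0 + x') * r = c *\<^sub>C r"
    by (simp add: x0r rq rr mult_scaleC_right)
  have eq: "x0 * p A - x0 * p A * ?q = c *\<^sub>C r"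
    using x0r by (simp add: r_def right_diff_distrib mult.assoc)
  show ?thesis
  proof (cases "r = 0")
    case False
    define R where "R = \<pi> r"
    have R: "star R = R" "R * R = R" "R \<noteq> 0"
      using star_r rr uncovered_faithful[OF F] False
      by (simp_all add: R_def r_def flip: \<pi>_mult \<pi>_star)
    then have nR: "norm R = 1" by (rule norm_projection)
    have "norm (c *\<^sub>C r) \<le> cmod c * norm R"
      using norm_projection_le[OF star_r rr] nR by (simp add: norm_scaleC mult_left_le)
    also have "\<dots> = norm (R * \<pi> (x0 + x') * R)"
      using arg_cong[OF rxr, of \<pi>] by (simp add: R_def \<pi>_mult \<pi>_scaleC norm_scaleC)
    also have "\<dots> \<le> norm R * norm (\<pi> (x0 + x')) * norm R"
      by (rule norm_mult3)
    finally show ?thesis using nR by (simp add: eq)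
  qed (use eq in simp)
qed

text \<open>
  Since \<open>q\<close> commutes with \<open>x\<^sub>0\<close>, the element splits as \<open>x = q x q + x\<^sub>0 (1 - q)\<close>. The first summand has
  one block per pair of labels and the second one summand per atom. What matters about the constant
  is that it does not depend on \<open>x\<close>.
\<close>

lemma core_estimate:
  assumes F: "finite F" "F \<subseteq> L"
    and x0: "x0 \<in> cvs.span (range p)" "\<And>A. A \<in> set As \<Longrightarrow> \<exists>c. x0 * p A = c *\<^sub>C p A"
      "sum_list (map p As) = p E" "x0 * p E = x0"
    and x': "dom.cover F * x' = x'" "x' * dom.cover F = x'"
    and x: "x = x0 + x'"
    and compress: "\<And>\<alpha> \<beta>. \<alpha> \<in> F \<Longrightarrow> \<beta> \<in> F \<Longrightarrow> norm (star (s \<alpha>) * x * s \<beta>) \<le> norm (\<pi> x)"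
  shows "norm x \<le> real (card F * card F + length As) * norm (\<pi> x)"
proof -
  let ?q = "dom.cover F"
  have qq: "?q * ?q = ?q" using dom.cover_cover[of F F] F by simp
  have comm: "x0 * ?q = ?q * x0"
    using x0(1) by (rule span_commute) (use F dom.p_cover_commute in auto)
  have "?q * x * ?q = x0 * ?q + x'"
    by (simp add: x distrib_left distrib_right x' flip: comm) (simp add: mult.assoc qq)
  then have split: "x = ?q * x * ?q + (x0 * p E - x0 * p E * ?q)"
    by (simp add: x x0)
  have "norm (?q * x * ?q) \<le> (\<Sum>\<alpha>\<in>F. \<Sum>\<beta>\<in>F. norm (\<pi> x))"
    unfolding dom.cover_compress
  proof (intro sum_norm_le order_trans[OF norm_sum] sum_mono)
    fix \<alpha> \<beta> assume ab: "\<alpha> \<in> F" "\<beta> \<in> F"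
    then have "norm (s \<alpha> * (star (s \<alpha>) * x * s \<beta>) * star (s \<beta>)) \<le> norm (star (s \<alpha>) * x * s \<beta>)"
      using F by (intro dom.norm_sandwich_le) auto
    then show "norm (s \<alpha> * (star (s \<alpha>) * x * s \<beta>) * star (s \<beta>)) \<le> norm (\<pi> x)"
      using compress[OF ab] by linarith
  qed
  then have 1: "norm (?q * x * ?q) \<le> real (card F * card F) * norm (\<pi> x)" by simp
  have "norm (x0 * sum_list (map p Bs) - x0 * sum_list (map p Bs) * ?q) \<le> real (length Bs) * norm (\<pi> x)"
    if "set Bs \<subseteq> set As" for Bs
    using that
  proof (induction Bs)
    case (Cons B Bs)
    obtain c where "x0 * p B = c *\<^sub>C p B" using Cons.prems x0(2) by auto
    then have "norm (x0 * p B - x0 * p B * ?q) \<le> norm (\<pi> x)"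
      unfolding x by (rule uncovered_corner_le[OF F x0(1) _ x'(1)])
    moreover have "x0 * sum_list (map p (B # Bs)) - x0 * sum_list (map p (B # Bs)) * ?q =
      (x0 * p B - x0 * p B * ?q) + (x0 * sum_list (map p Bs) - x0 * sum_list (map p Bs) * ?q)"
      by (simp add: algebra_simps)
    ultimately show ?case
      using Cons norm_triangle_ineq[of "x0 * p B - x0 * p B * ?q"
          "x0 * sum_list (map p Bs) - x0 * sum_list (map p Bs) * ?q"]
      by (simp only: list.size set_simps) (auto simp: algebra_simps)
  qed simp
  then have 2: "norm (x0 * p E - x0 * p E * ?q) \<le> real (length As) * norm (\<pi> x)"
    using x0(3) by (metis order_refl)
  have "norm x \<le> norm (?q * x * ?q) + norm (x0 * p E - x0 * p E * ?q)"
    by (subst split) (rule norm_triangle_ineq)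
  then show ?thesis using 1 2 by (simp add: algebra_simps)
qed

text \<open>
  The elements that split with respect to a fixed \<open>F\<close> and fixed atoms form a star-algebra \<open>Q\<close>, because \<open>x'\<close> ranges over an
  ideal of it. So the preceding estimate holds with one constant for all powers, and the power trick removes the
  constant. The set \<open>Y\<close> stands for a stage of the core; it only serves to make the compression
  hypothesis available for those powers.
\<close>

lemma norm_le_if_compressions:
  assumes Y: "\<And>y. y \<in> Y \<Longrightarrow> star y \<in> Y" "\<And>y z. y \<in> Y \<Longrightarrow> z \<in> Y \<Longrightarrow> y * z \<in> Y"
    and compress: "\<And>y \<alpha> \<beta>. y \<in> Y \<Longrightarrow> \<alpha> \<in> F \<Longrightarrow> \<beta> \<in> F \<Longrightarrow>
      norm (star (s \<alpha>) * y * s \<beta>) \<le> norm (\<pi> y)"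
    and F: "finite F" "F \<subseteq> L" and x: "x \<in> Y" "x = x0 + x'"
    and x0: "x0 \<in> cvs.span (range p)"
    and x': "dom.cover F * x' = x'" "x' * dom.cover F = x'"
  shows "norm x \<le> norm (\<pi> x)"
proof -
  let ?q = "dom.cover F"
  obtain As E where As: "\<And>A. A \<in> set As \<Longrightarrow> \<exists>c. x0 * p A = c *\<^sub>C p A"
    "sum_list (map p As) = p E" "x0 * p E = x0"
    using dom.diagonalize[OF x0] by metis
  define D where "D y \<longleftrightarrow> y \<in> cvs.span (range p) \<and> (\<forall>A\<in>set As. \<exists>c. y * p A = c *\<^sub>C p A) \<and> y * p E = y" for y
  define Q where "Q y \<longleftrightarrow> y \<in> Y \<and> (\<exists>y0 y'. y = y0 + y' \<and> D y0 \<and> ?q * y' = y' \<and> y' * ?q = y')" for y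
  have comm_p: "y * p A = p A * y" if "y \<in> cvs.span (range p)" for y A
    using that by (rule span_commute) (auto simp: dom.p_mult inf.commute)
  have comm_q: "y * ?q = ?q * y" if "y \<in> cvs.span (range p)" for y
    using that by (rule span_commute) (use F dom.p_cover_commute in auto)
  have D_star: "D (star y)" if Dy: "D y" for y
    unfolding D_def
  proof (intro conjI ballI)
    have y: "y \<in> cvs.span (range p)" using Dy by (simp add: D_def)
    then show "star y \<in> cvs.span (range p)"
      by (rule span_star) (auto simp: dom.star_p intro: cvs.span_base)
    have eq: "star y * p A = star (y * p A)" for A
      by (simp add: comm_p[OF y] star_mult dom.star_p)
    show "star y * p E = star y" using Dy by (simp add: eq D_def)
    fix A assume "A \<in> set As"
    then obtain c where "y * p A = c *\<^sub>C p A" using Dy by (auto simp: D_def)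
    then have "star y * p A = cnj c *\<^sub>C p A" by (simp add: eq star_scaleC dom.star_p)
    then show "\<exists>c. star y * p A = c *\<^sub>C p A" ..
  qed
  have D_mult: "D (y * z)" if Dyz: "D y" "D z" for y z
    unfolding D_def
  proof (intro conjI ballI)
    show "y * z \<in> cvs.span (range p)"
      using Dyz unfolding D_def
      by (intro span_mult[of y "range p" z "range p"]) (auto simp: dom.p_mult intro: cvs.span_base)
    show "y * z * p E = y * z" using Dyz by (simp add: D_def mult.assoc)
    fix A assume "A \<in> set As"
    then obtain c d where "y * p A = c *\<^sub>C p A" "z * p A = d *\<^sub>C p A"
      using Dyz unfolding D_def by blast
    then have "y * z * p A = (d * c) *\<^sub>C p A" by (simp add: mult.assoc mult_scaleC_right scaleC_scaleC)
    then show "\<exists>c. y * z * p A = c *\<^sub>C p A" ..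
  qed
  have Q_star: "Q (star y)" if Qy: "Q y" for y
  proof -
    obtain y0 y' where y: "y = y0 + y'" "D y0" "?q * y' = y'" "y' * ?q = y'" "y \<in> Y"
      using Qy by (auto simp: Q_def)
    have "?q * star y' = star y'" "star y' * ?q = star y'"
      using arg_cong[OF y(4), of star] arg_cong[OF y(3), of star]
      by (simp_all add: star_mult dom.star_cover)
    moreover have "star y = star y0 + star y'" by (simp add: y star_add)
    ultimately show ?thesis
      using Y(1)[OF y(5)] D_star[OF y(2)] unfolding Q_def by blast
  qed
  have Q_mult: "Q (y * z)" if Qyz: "Q y" "Q z" for y z
  proof -
    obtain y0 y' where y: "y = y0 + y'" "D y0" "?q * y' = y'" "y' * ?q = y'" "y \<in> Y"
      using Qyz by (auto simp: Q_def)
    obtain z0 z' where z: "z = z0 + z'" "D z0" "?q * z' = z'" "z' * ?q = z'" "z \<in> Y"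
      using Qyz by (auto simp: Q_def)
    have c: "?q * y0 = y0 * ?q" "?q * z0 = z0 * ?q" using y z comm_q by (auto simp: D_def)
    define w where "w = y0 * z' + y' * z0 + y' * z'"
    have "?q * (y0 * z') = y0 * z'" "(y' * z0) * ?q = y' * z0"
      using c y(4) z(3) by (metis mult.assoc)+
    moreover have "?q * (y' * v) = y' * v" for v using y(3) by (simp flip: mult.assoc)
    moreover have "v * z' * ?q = v * z'" for v using z(4) by (simp add: mult.assoc)
    ultimately have "?q * w = w" "w * ?q = w"
      by (simp_all add: w_def distrib_left distrib_right)
    moreover have "y * z = y0 * z0 + w" by (simp add: y z w_def algebra_simps)
    ultimately show ?thesis
      using D_mult[OF y(2) z(2)] Y(2)[OF y(5) z(5)] unfolding Q_def by blast
  qed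
  have Q_norm: "norm y \<le> real (card F * card F + length As) * norm (\<pi> y)" if Qy: "Q y" for y
  proof -
    obtain y0 y' where y: "y = y0 + y'" "D y0" "?q * y' = y'" "y' * ?q = y'" "y \<in> Y"
      using Qy by (auto simp: Q_def)
    show ?thesis
      by (rule core_estimate[OF F _ _ As(2) _ y(3,4,1)]) (use y compress in \<open>auto simp: D_def\<close>)
  qed
  have "Q x" using x x0 x' As unfolding Q_def D_def by blast
  have Q_iter: "Q (iter_square n (star x * x))" for n
    by (induction n) (auto intro: Q_mult Q_star \<open>Q x\<close>)
  show ?thesis
  proof (rule norm_le_if_powers_linear[OF star_hom])
    fix n
    let ?K = "real (card F * card F + length As)" and ?y = "iter_square n (star x * x)"
    have "norm ?y \<le> ?K * norm (\<pi> ?y)" by (rule Q_norm[OF Q_iter])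
    also have "\<dots> \<le> ?K * 2 ^ n * norm (\<pi> ?y)"
      by (intro mult_right_mono) (auto simp: mult_le_cancel_left1 simp del: of_nat_add of_nat_mult)
    finally show "norm ?y \<le> ?K * 2 ^ n * norm (\<pi> ?y)" .
  qed
qed

lemma norm_core_le: "x \<in> dom.core n \<Longrightarrow> norm x \<le> norm (\<pi> x)"
proof (induction n arbitrary: x)
  case 0
  show ?case
  proof (rule norm_le_if_compressions[of "dom.core 0" "{}" x x 0])
    show "x \<in> cvs.span (range p)" using 0 by simp
  qed (use 0 dom.star_in_core[of _ 0] dom.core_mult[of _ 0] in auto)
next
  case (Suc n)
  obtain x0 x' F where x: "x = x0 + x'" "x0 \<in> cvs.span (range p)" "finite F" "F \<subseteq> L"
    "dom.cover F * x' = x'" "x' * dom.cover F = x'"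
    using dom.core_decompose[OF Suc.prems] by blast
  show ?case
  proof (rule norm_le_if_compressions[of "dom.core (Suc n)" F x x0 x'])
    fix y \<alpha> \<beta> assume y: "y \<in> dom.core (Suc n)" "\<alpha> \<in> F" "\<beta> \<in> F"
    then have L: "\<alpha> \<in> L" "\<beta> \<in> L" using x by auto
    have "norm (star (s \<alpha>) * y * s \<beta>) \<le> norm (\<pi> (star (s \<alpha>) * y * s \<beta>))"
      by (rule Suc.IH[OF dom.core_compress[OF y(1) L]])
    also have "\<dots> \<le> norm (\<pi> y)"
      using cod.norm_compress_le[OF L] L by (simp add: \<pi>_mult \<pi>_star \<pi>_s)
    finally show "norm (star (s \<alpha>) * y * s \<beta>) \<le> norm (\<pi> y)" .
  qed (use Suc.prems x dom.star_in_core dom.core_mult in \<open>auto simp del: dom.core.simps\<close>)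
qed

end

section \<open>Fourier coefficients and density\<close>

lemma sum_cis_eq_0:
  fixes m :: int
  assumes "m \<noteq> 0" "\<bar>m\<bar> < int N"
  shows "(\<Sum>j<N. cis (real_of_int m * (2 * pi * real j / real N))) = 0"
proof -
  define w where "w = cis (2 * pi * real_of_int m / real N)"
  have N: "real N > 0" using assms by auto
  have "w ^ j = cis (real j * (2 * pi * real_of_int m / real N))" for j
    unfolding w_def by (rule Complex.DeMoivre)
  then have "cis (real_of_int m * (2 * pi * real j / real N)) = w ^ j" for j
    by (simp add: mult_ac)
  then have "(\<Sum>j<N. cis (real_of_int m * (2 * pi * real j / real N))) = (\<Sum>j<N. w ^ j)"
    by simp
  moreover have "w \<noteq> 1"
  proof
    assume "w = 1"
    then have "exp (\<i> * complex_of_real (2 * pi * real_of_int m / real N)) = 1"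
      by (simp add: w_def cis_conv_exp)
    then obtain n :: int where "2 * pi * real_of_int m / real N = of_int (2 * n) * pi"
      by (auto simp: exp_eq_1)
    then have "real_of_int m = of_int (n * int N)" using N by (simp add: field_simps)
    then have "m = n * int N" by (simp only: of_int_eq_iff)
    then show False using assms by (cases "n = 0") (auto simp: abs_mult)
  qed
  moreover have "w ^ N = 1"
  proof -
    have "w ^ N = cis (2 * pi * real_of_int m)" using N by (simp add: w_def Complex.DeMoivre)
    then show ?thesis by (simp add: cis_multiple_2pi)
  qed
  ultimately show ?thesis using sum_gp_strict[of w N] by simp
qed

text \<open>
  For a trigonometric polynomial of degree \<open>d\<close>, averaging over the \<open>(2d + 1)\<close>-th roots of unity isolates
  a coefficient exactly, since two frequencies differ by less than \<open>2d + 1\<close>. This replaces the integral over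
  the circle.
\<close>

lemma trig_coefficient_le:
  fixes v :: "int \<Rightarrow> 'a::cstar_algebra"
  assumes bound: "\<And>t. norm (\<Sum>k=-d..d. cis (real_of_int k * t) *\<^sub>C v k) \<le> C"
    and k: "k \<in> {-d..d}"
  shows "norm (v k) \<le> C"
proof -
  define N where "N = nat (2 * d + 1)"
  have N: "int N = 2 * d + 1" "real N > 0" using k by (auto simp: N_def)
  define t where "t j = 2 * pi * real j / real N" for j :: nat
  have "(\<Sum>j<N. cis (- real_of_int k * t j) *\<^sub>C (\<Sum>l=-d..d. cis (real_of_int l * t j) *\<^sub>C v l))
      = (\<Sum>l=-d..d. (\<Sum>j<N. cis (real_of_int (l - k) * t j)) *\<^sub>C v l)"
    by (subst sum.swap[of _ "{-d..d}"] | simp add: cvs.scale_sum_right cvs.scale_sum_left scaleC_scaleC cis_mult algebra_simps)+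
  also have "\<dots> = (\<Sum>l=-d..d. if l = k then of_nat N *\<^sub>C v k else 0)"
  proof (rule sum.cong)
    fix l assume "l \<in> {-d..d}"
    then have "(\<Sum>j<N. cis (real_of_int (l - k) * t j)) = 0" if "l \<noteq> k"
      using that k N unfolding t_def by (intro sum_cis_eq_0) auto
    then show "(\<Sum>j<N. cis (real_of_int (l - k) * t j)) *\<^sub>C v l = (if l = k then of_nat N *\<^sub>C v k else 0)"
      by auto
  qed simp
  also have "\<dots> = of_nat N *\<^sub>C v k" using k by simp
  finally have eq: "of_nat N *\<^sub>C v k =
    (\<Sum>j<N. cis (- real_of_int k * t j) *\<^sub>C (\<Sum>l=-d..d. cis (real_of_int l * t j) *\<^sub>C v l))" ..
  have "real N * norm (v k) \<le> (\<Sum>j<N. C)"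
    unfolding norm_scaleC[of "of_nat N" "v k", simplified, symmetric] eq
    by (intro order_trans[OF norm_sum] sum_mono) (simp only: norm_scaleC norm_cis mult_1 bound)
  then show ?thesis using N by simp
qed

lemma cstar_subalgebra_closure:
  fixes T :: "'a::cstar_algebra set"
  assumes "0 \<in> T" "\<And>x y. x \<in> T \<Longrightarrow> y \<in> T \<Longrightarrow> x + y \<in> T" "\<And>x y. x \<in> T \<Longrightarrow> y \<in> T \<Longrightarrow> x * y \<in> T"
    "\<And>x. x \<in> T \<Longrightarrow> star x \<in> T" "\<And>x c. x \<in> T \<Longrightarrow> c *\<^sub>C x \<in> T"
  shows "cstar_subalgebra (closure T)"
proof -
  have image: "f x \<in> closure T" if "x \<in> closure T" "continuous_on UNIV f" "\<And>y. y \<in> T \<Longrightarrow> f y \<in> T"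
    for f :: "'a \<Rightarrow> 'a" and x
  proof -
    have "f ` closure T \<subseteq> closure T"
      using that by (intro image_closure_subset) (auto intro: continuous_on_subset closure_subset[THEN subsetD])
    then show ?thesis using that by auto
  qed
  have scale: "continuous_on UNIV (\<lambda>x. c *\<^sub>C x :: 'a)" for c
  proof (rule continuous_on_subset[OF bounded_linear.continuous_on[OF _ continuous_on_id]])
    show "bounded_linear (\<lambda>x. c *\<^sub>C x :: 'a)"
      by (rule bounded_linear_intro[of _ "cmod c"])
        (auto simp: scaleC_add_right scaleR_eq_scaleC scaleC_scaleC norm_scaleC mult.commute)
  qed auto
  have "x + y \<in> closure T \<and> x * y \<in> closure T" if "x \<in> closure T" "y \<in> closure T" for x y
  proof -
    obtain X Y where "\<And>n. X n \<in> T" "X \<longlonglongrightarrow> x" "\<And>n. Y n \<in> T" "Y \<longlonglongrightarrow> y"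
      using \<open>x \<in> closure T\<close> \<open>y \<in> closure T\<close> by (metis closure_sequential)
    then have lim: "(\<lambda>n. X n + Y n) \<longlonglongrightarrow> x + y" "(\<lambda>n. X n * Y n) \<longlonglongrightarrow> x * y"
      and "X n + Y n \<in> T" "X n * Y n \<in> T" for n
      using assms(2,3) by (auto intro: tendsto_intros)
    then have mem: "X n + Y n \<in> closure T" "X n * Y n \<in> closure T" for n
      using closure_subset by blast+
    show ?thesis
      using closed_sequentially[OF closed_closure mem(1) lim(1)]
        closed_sequentially[OF closed_closure mem(2) lim(2)] by blast
  qed
  moreover have "0 \<in> closure T" using assms(1) closure_subset by blast
  moreover have "star x \<in> closure T" if "x \<in> closure T" for x
    by (rule image[OF that continuous_star assms(4)])
  moreover have "c *\<^sub>C x \<in> closure T" if "x \<in> closure T" for c x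
    by (rule image[OF that scale assms(5)])
  ultimately show ?thesis by (simp add: cstar_subalgebra_def)
qed

lemma ck_algebra_minimal:
  assumes "cstar_subalgebra T" "range p \<subseteq> T" "s ` L \<subseteq> T"
  shows "ck_algebra L p s \<subseteq> T"
  unfolding ck_algebra_def by (rule hull_minimal) (use assms in auto)

lemma cstar_subalgebra_ck_algebra: "cstar_subalgebra (ck_algebra L p s)"
  unfolding ck_algebra_def
proof (rule hull_in)
  fix T :: "'a set set" assume "\<forall>X\<in>T. cstar_subalgebra X"
  then show "cstar_subalgebra (\<Inter> T)"
    by (auto simp: cstar_subalgebra_def intro!: closed_Inter)
qed

section \<open>The grading\<close>

context cuntz_krieger begin

primrec paths :: "nat \<Rightarrow> 'u set" where
  "paths 0 = range p"
| "paths (Suc n) = {s \<alpha> * a | \<alpha> a. \<alpha> \<in> L \<and> a \<in> paths n}"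

lemma p_mult_paths: "a \<in> paths n \<Longrightarrow> p A * a \<in> paths n"
proof (induction n arbitrary: a A)
  case (Suc n)
  then obtain \<alpha> b where a: "a = s \<alpha> * b" "\<alpha> \<in> L" "b \<in> paths n" by auto
  then have "p A * a = s \<alpha> * (p (\<theta> \<alpha> A) * b)" by (simp add: p_s flip: mult.assoc)
  then show ?case using a Suc.IH by auto
qed (auto simp: p_mult)

lemma paths_mult: "a \<in> paths m \<Longrightarrow> b \<in> paths n \<Longrightarrow> a * b \<in> paths (m + n)"
proof (induction m arbitrary: a)
  case (Suc m)
  then obtain \<alpha> c where a: "a = s \<alpha> * c" "\<alpha> \<in> L" "c \<in> paths m" by auto
  then have "a * b = s \<alpha> * (c * b)" by (simp add: mult.assoc)
  then show ?case using a Suc by auto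
qed (auto intro: p_mult_paths)

text \<open>
  The shorter of the two paths is cancelled label by label. A mismatch gives \<open>0\<close>, which has to be
  listed separately: if \<open>L\<close> is empty there are no paths of positive length, not even \<open>0\<close>.
\<close>

lemma star_paths_mult_paths:
  "a \<in> paths m \<Longrightarrow> b \<in> paths (m + n) \<Longrightarrow> star a * b \<in> insert 0 (paths n)"
proof (induction m arbitrary: a b)
  case 0
  then show ?case by (auto simp: star_p intro: p_mult_paths)
next
  case (Suc m)
  obtain \<alpha> c where a: "a = s \<alpha> * c" "\<alpha> \<in> L" "c \<in> paths m" using Suc.prems by auto
  obtain \<beta> d where b: "b = s \<beta> * d" "\<beta> \<in> L" "d \<in> paths (m + n)" using Suc.prems by auto
  have "star a * b = star c * ((star (s \<alpha>) * s \<beta>) * d)"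
    by (simp add: a b star_mult mult.assoc)
  then show ?case
    using Suc.IH[OF a(3) p_mult_paths[OF b(3)]] a b by (auto simp: star_s_s)
qed

definition monomials :: "int \<Rightarrow> 'u set" where
  "monomials k = {a * star b | a b m n. a \<in> paths m \<and> b \<in> paths n \<and> int m - int n = k}"

lemma monomialsI: "a \<in> paths m \<Longrightarrow> b \<in> paths n \<Longrightarrow> int m - int n = k \<Longrightarrow> a * star b \<in> monomials k"
  by (auto simp: monomials_def)

lemma monomialsE:
  assumes "x \<in> monomials k"
  obtains a b m n where "x = a * star b" "a \<in> paths m" "b \<in> paths n" "int m - int n = k"
  using assms by (auto simp: monomials_def)

lemma monomials_mult:
  assumes "x \<in> monomials j" "y \<in> monomials k"
  shows "x * y \<in> insert 0 (monomials (j + k))"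
proof -
  obtain a b m n where x: "x = a * star b" "a \<in> paths m" "b \<in> paths n" "int m - int n = j"
    using assms(1) by (rule monomialsE)
  obtain c d m' n' where y: "y = c * star d" "c \<in> paths m'" "d \<in> paths n'" "int m' - int n' = k"
    using assms(2) by (rule monomialsE)
  have xy: "x * y = a * (star b * c) * star d" by (simp add: x y mult.assoc)
  consider "star b * c = 0" | e where "n \<le> m'" "star b * c = e" "e \<in> paths (m' - n)"
    | e where "m' \<le> n" "star b * c = star e" "e \<in> paths (n - m')"
  proof (cases "n \<le> m'")
    case True
    then show thesis using star_paths_mult_paths[of b n c "m' - n"] x y that by auto
  next
    case False
    have "star b * c = star (star c * b)" by (simp add: star_mult star_star)
    then show thesis using False star_paths_mult_paths[of c m' b "n - m'"] x y that by auto
  qed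
  then show ?thesis
  proof cases
    case 1
    then show ?thesis by (simp add: xy)
  next
    case 2
    then have "a * e \<in> paths (m + (m' - n))" using x paths_mult by blast
    then have "a * e * star d \<in> monomials (j + k)"
      by (rule monomialsI[OF _ y(3)]) (use 2 x y in auto)
    then show ?thesis by (simp add: xy 2)
  next
    case 3
    then have "d * e \<in> paths (n' + (n - m'))" using y paths_mult by blast
    then have "a * star (d * e) \<in> monomials (j + k)"
      by (rule monomialsI[OF x(2)]) (use 3 x y in auto)
    then show ?thesis by (simp add: xy 3 star_mult mult.assoc)
  qed
qed

lemma star_monomials: "x \<in> monomials k \<Longrightarrow> star x \<in> monomials (- k)"
proof (erule monomialsE)
  fix a b m n assume x: "x = a * star b" "a \<in> paths m" "b \<in> paths n" "int m - int n = k"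
  then have "b * star a \<in> monomials (- k)" by (intro monomialsI[OF x(3,2)]) auto
  then show ?thesis by (simp add: x(1) star_mult star_star)
qed

lemma p_in_monomials: "p A \<in> monomials 0"
  using monomialsI[of "p A" 0 "p A" 0 0] by (simp add: star_p p_mult)

lemma s_in_monomials: "\<alpha> \<in> L \<Longrightarrow> s \<alpha> \<in> monomials 1"
proof -
  assume \<alpha>: "\<alpha> \<in> L"
  let ?R = "p (range_top (\<theta> \<alpha>))"
  have "s \<alpha> * ?R \<in> paths 1" "?R \<in> paths 0" using \<alpha> by auto
  then have "s \<alpha> * ?R * star ?R \<in> monomials 1" by (rule monomialsI) simp
  then show ?thesis using \<alpha> by (simp add: star_p s_range_top)
qed

lemma balanced_in_core: "a \<in> paths n \<Longrightarrow> b \<in> paths n \<Longrightarrow> a * star b \<in> core n"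
proof (induction n arbitrary: a b)
  case (Suc n)
  obtain \<alpha> c where a: "a = s \<alpha> * c" "\<alpha> \<in> L" "c \<in> paths n" using Suc.prems by auto
  obtain \<beta> d where b: "b = s \<beta> * d" "\<beta> \<in> L" "d \<in> paths n" using Suc.prems by auto
  have "a * star b = s \<alpha> * (c * star d) * star (s \<beta>)" by (simp add: a b star_mult mult.assoc)
  then show ?case using sandwich_in_core[OF a(2) b(2) Suc.IH[OF a(3) b(3)]] by (simp only:)
qed (auto simp: star_p p_mult intro: cvs.span_base)

text \<open>
  The algebraic part of the spectral subspace of the gauge action for the character \<open>z \<mapsto> z\<^bsup>k\<^esup>\<close>.
\<close>

definition homogeneous :: "int \<Rightarrow> 'u set" where
  "homogeneous k = cvs.span (monomials k)"

lemma homogeneous_0_core: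
  assumes "x \<in> homogeneous 0" shows "\<exists>n. x \<in> core n"
  using assms unfolding homogeneous_def
proof (induction rule: cvs.span_induct)
  case (step a)
  then obtain b c m n where "a = b * star c" "b \<in> paths m" "c \<in> paths n" "int m - int n = 0"
    by (rule monomialsE)
  then show ?case using balanced_in_core[of b m c] by auto
next
  case base
  have "\<exists>k. x + y \<in> core k" if "x \<in> core m" "y \<in> core n" for x y m n
    using that core_mono[of m "max m n"] core_mono[of n "max m n"]
    by (intro exI[of _ "max m n"] cvs.subspace_add[OF subspace_core]) auto
  then show ?case
    using zero_in_core cvs.subspace_scale[OF subspace_core] unfolding cvs.subspace_def by blast
qed

lemma star_mult_self_homogeneous:
  assumes "x \<in> homogeneous k" shows "star x * x \<in> homogeneous 0"
proof -
  have "star x \<in> cvs.span (monomials (- k))"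
    using assms unfolding homogeneous_def
    by (rule span_star) (auto intro: cvs.span_base star_monomials)
  then show ?thesis
    using assms unfolding homogeneous_def
  proof (rule span_mult)
    fix a b assume "a \<in> monomials (- k)" "b \<in> monomials k"
    then have "a * b = 0 \<or> a * b \<in> monomials 0" using monomials_mult[of a "- k" b k] by simp
    then show "a * b \<in> cvs.span (monomials 0)" by (auto intro: cvs.span_zero cvs.span_base)
  qed
qed

definition polynomials :: "int \<Rightarrow> 'u set" where
  "polynomials d = cvs.span (\<Union>k\<in>{-d..d}. monomials k)"

lemma polynomials_mono: "d \<le> e \<Longrightarrow> polynomials d \<subseteq> polynomials e"
  unfolding polynomials_def by (intro cvs.span_mono UN_mono) auto

lemma star_polynomials: "x \<in> polynomials d \<Longrightarrow> star x \<in> polynomials d"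
  unfolding polynomials_def
proof (erule span_star)
  fix a assume "a \<in> (\<Union>k\<in>{-d..d}. monomials k)"
  then obtain k where "k \<in> {-d..d}" "a \<in> monomials k" by blast
  then have "- k \<in> {-d..d}" "star a \<in> monomials (- k)" by (auto intro: star_monomials)
  then show "star a \<in> cvs.span (\<Union>k\<in>{-d..d}. monomials k)" by (blast intro: cvs.span_base)
qed

lemma polynomials_mult:
  assumes "x \<in> polynomials d" "y \<in> polynomials e"
  shows "x * y \<in> polynomials (d + e)"
  using assms unfolding polynomials_def
proof (rule span_mult)
  fix a b assume "a \<in> (\<Union>k\<in>{-d..d}. monomials k)" "b \<in> (\<Union>k\<in>{-e..e}. monomials k)"
  then obtain j k where jk: "j \<in> {-d..d}" "k \<in> {-e..e}" "a \<in> monomials j" "b \<in> monomials k" by blast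
  then have "a * b = 0 \<or> a * b \<in> monomials (j + k)" using monomials_mult by blast
  moreover have "monomials (j + k) \<subseteq> (\<Union>k\<in>{- (d + e)..d + e}. monomials k)"
    using jk by (intro UN_upper) auto
  ultimately show "a * b \<in> cvs.span (\<Union>k\<in>{- (d + e)..d + e}. monomials k)"
    using cvs.span_zero cvs.span_superset by (metis subset_iff)
qed

lemma polynomial_components:
  assumes "x \<in> polynomials d"
  obtains v where "\<And>k. v k \<in> homogeneous k" "x = (\<Sum>k=-d..d. v k)"
proof -
  have "\<exists>v. (\<forall>k. v k \<in> homogeneous k) \<and> x = (\<Sum>k=-d..d. v k)"
    using assms unfolding polynomials_def
  proof (induction rule: cvs.span_induct)
    case (step a)
    then obtain k where "k \<in> {-d..d}" "a \<in> monomials k" by blast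
    then show ?case
      by (intro exI[of _ "\<lambda>j. if j = k then a else 0"])
        (auto simp: homogeneous_def intro: cvs.span_base cvs.span_zero)
  next
    case base
    show ?case
      unfolding cvs.subspace_def mem_Collect_eq
    proof (intro conjI ballI allI; (elim CollectE exE conjE)?)
      show "\<exists>v. (\<forall>k. v k \<in> homogeneous k) \<and> 0 = (\<Sum>k=-d..d. v k)"
        by (intro exI[of _ "\<lambda>_. 0"]) (auto simp: homogeneous_def intro: cvs.span_zero)
    next
      fix x y v w
      assume "\<forall>k. v k \<in> homogeneous k" "x = (\<Sum>k=-d..d. v k)" "\<forall>k. w k \<in> homogeneous k" "y = (\<Sum>k=-d..d. w k)"
      then show "\<exists>v. (\<forall>k. v k \<in> homogeneous k) \<and> x + y = (\<Sum>k=-d..d. v k)"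
        by (intro exI[of _ "\<lambda>k. v k + w k"]) (auto simp: homogeneous_def sum.distrib intro: cvs.span_add)
    next
      fix c x v
      assume "\<forall>k. v k \<in> homogeneous k" "x = (\<Sum>k=-d..d. v k)"
      then show "\<exists>v. (\<forall>k. v k \<in> homogeneous k) \<and> c *\<^sub>C x = (\<Sum>k=-d..d. v k)"
        by (intro exI[of _ "\<lambda>k. c *\<^sub>C v k"]) (auto simp: homogeneous_def cvs.scale_sum_right intro: cvs.span_scale)
    qed
  qed
  then show thesis using that by blast
qed

lemma polynomials_dense: "ck_algebra L p s \<subseteq> closure (\<Union>d. polynomials (int d))"
proof (rule ck_algebra_minimal)
  let ?T = "\<Union>d. polynomials (int d)"
  have mem: "x \<in> ?T" if "x \<in> monomials k" for x k
  proof -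
    have "x \<in> (\<Union>j\<in>{-\<bar>k\<bar>..\<bar>k\<bar>}. monomials j)" using that by (intro UN_I[of k]) auto
    then have "x \<in> polynomials (int (nat \<bar>k\<bar>))" by (simp add: polynomials_def cvs.span_base)
    then show ?thesis by blast
  qed
  have "range p \<subseteq> ?T" using mem[OF p_in_monomials] by (rule image_subsetI)
  then show "range p \<subseteq> closure ?T" using closure_subset by (rule order_trans)
  have "s ` L \<subseteq> ?T" using mem[OF s_in_monomials] by (rule image_subsetI)
  then show "s ` L \<subseteq> closure ?T" using closure_subset by (rule order_trans)
  show "cstar_subalgebra (closure ?T)"
  proof (rule cstar_subalgebra_closure)
    have "0 \<in> polynomials (int 0)" unfolding polynomials_def by (rule cvs.span_zero)
    then show "0 \<in> ?T" by blast
    fix x assume "x \<in> ?T"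
    then obtain d where d: "x \<in> polynomials (int d)" by blast
    then show "star x \<in> ?T" using star_polynomials by blast
    have "c *\<^sub>C x \<in> polynomials (int d)" for c
      using d unfolding polynomials_def by (rule cvs.span_scale)
    then show "c *\<^sub>C x \<in> ?T" for c by blast
    fix y assume "y \<in> ?T"
    then obtain e where e: "y \<in> polynomials (int e)" by blast
    have "x * y \<in> polynomials (int (d + e))" using polynomials_mult[OF d e] by simp
    then show "x * y \<in> ?T" by blast
    have "x \<in> polynomials (int (d + e))" "y \<in> polynomials (int (d + e))"
      using d e polynomials_mono[of "int d" "int (d + e)"] polynomials_mono[of "int e" "int (d + e)"] by auto
    then have "x + y \<in> polynomials (int (d + e))"
      unfolding polynomials_def by (rule cvs.span_add)
    then show "x + y \<in> ?T" by blast
  qed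
qed

lemma gauge_homogeneous:
  assumes \<beta>: "gauge_action L p s \<beta>" and x: "x \<in> homogeneous k"
  shows "\<beta> (cis t) x = cis (real_of_int k * t) *\<^sub>C x"
proof -
  have z: "cis t \<in> sphere 0 1" by simp
  then have "star_hom cstar_univ cstar_univ (\<beta> (cis t))"
    and gen: "\<beta> (cis t) (p A) = p A" "\<alpha> \<in> L \<Longrightarrow> \<beta> (cis t) (s \<alpha>) = cis t *\<^sub>C s \<alpha>" for A \<alpha>
    using \<beta> unfolding gauge_action_def circle_action_def by blast+
  note hom = star_hom_cstar_onD[OF this(1), simplified]
  have paths: "\<beta> (cis t) a = cis (real n * t) *\<^sub>C a" if "a \<in> paths n" for a n
    using that
  proof (induction n arbitrary: a)
    case (Suc n)
    then obtain \<alpha> b where a: "a = s \<alpha> * b" "\<alpha> \<in> L" "b \<in> paths n" by auto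
    then show ?case
      using Suc.IH[OF a(3)]
      by (simp add: hom gen mult_scaleC_left mult_scaleC_right scaleC_scaleC cis_mult algebra_simps)
  qed (auto simp: gen)
  show ?thesis
    using x unfolding homogeneous_def
  proof (induction rule: cvs.span_induct)
    case (step a)
    then obtain b c m n where a: "a = b * star c" "b \<in> paths m" "c \<in> paths n" "int m - int n = k"
      by (rule monomialsE)
    have k: "real_of_int k * t = real m * t + - (real n * t)"
      by (simp add: algebra_simps flip: a(4))
    show ?case
      unfolding k cis_mult[symmetric]
      by (simp add: a(1) hom star_scaleC cis_cnj mult_scaleC_left mult_scaleC_right scaleC_scaleC
          paths[OF a(2)] paths[OF a(3)] mult.commute)
  next
    case base
    have "\<beta> (cis t) 0 = 0" using hom(4)[of 0 0] by simp
    then show ?case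
      by (auto simp: cvs.subspace_def hom scaleC_add_right scaleC_scaleC mult.commute)
  qed
qed

end

section \<open>Gauge-invariant uniqueness\<close>

context ck_morphism begin

lemma norm_homogeneous_le:
  assumes "x \<in> dom.homogeneous k" shows "norm x \<le> norm (\<pi> x)"
proof -
  obtain n where "star x * x \<in> dom.core n"
    using dom.homogeneous_0_core[OF dom.star_mult_self_homogeneous[OF assms]] by blast
  then have "norm (star x * x) \<le> norm (\<pi> (star x * x))" by (rule norm_core_le)
  then show ?thesis by (simp add: \<pi>_mult \<pi>_star cstar_identity power2_le_iff_abs_le)
qed

text \<open>
  The hypothesis \<open>invariant\<close> is all that remains of the action \<open>\<gamma>\<close> on the image. It bounds the trigonometric
  polynomial \<open>t \<mapsto> \<pi> (\<beta> (cis t) x)\<close>, whose coefficients are the images of the homogeneous components.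
\<close>

lemma norm_polynomial_le:
  assumes \<beta>: "gauge_action L p s \<beta>"
    and invariant: "\<And>t x. norm (\<pi> (\<beta> (cis t) x)) \<le> norm (\<pi> x)"
    and x: "x \<in> dom.polynomials d" and d: "0 \<le> d"
  shows "norm x \<le> (2 * real_of_int d + 1) * norm (\<pi> x)"
proof -
  obtain v where v: "\<And>k. v k \<in> dom.homogeneous k" "x = (\<Sum>k=-d..d. v k)"
    using dom.polynomial_components[OF x] by blast
  have "star_hom cstar_univ cstar_univ (\<beta> (cis t))" for t
    using \<beta> unfolding gauge_action_def circle_action_def by simp
  note hom = star_hom_cstar_onD[OF this, simplified]
  have \<beta>_sum: "\<beta> (cis t) (sum v A) = (\<Sum>k\<in>A. \<beta> (cis t) (v k))" for t A
    using hom(4)[of t 0 0] by (induction A rule: infinite_finite_induct) (auto simp: hom)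
  have "norm (v k) \<le> norm (\<pi> x)" if k: "k \<in> {-d..d}" for k
  proof -
    have "norm (\<Sum>k=-d..d. cis (real_of_int k * t) *\<^sub>C \<pi> (v k)) \<le> norm (\<pi> x)" for t
      using invariant[of t x]
      by (simp add: v(2) \<beta>_sum \<pi>_sum \<pi>_scaleC dom.gauge_homogeneous[OF \<beta> v(1)])
    then have "norm (\<pi> (v k)) \<le> norm (\<pi> x)" using k by (rule trig_coefficient_le)
    then show ?thesis using norm_homogeneous_le[OF v(1)[of k]] by linarith
  qed
  then have "norm x \<le> (\<Sum>k=-d..d. norm (\<pi> x))"
    unfolding v(2) by (intro order_trans[OF norm_sum] sum_mono) (simp flip: v(2))
  then show ?thesis using d by simp
qed

text \<open>
  The power with exponent \<open>2\<^bsup>n\<^esup>\<close> of \<open>x\<^sup>* x\<close> has degree at most \<open>2\<^bsup>n\<^esup> \<sqdot> 2d\<close>: linear growth, as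
  the power trick requires.
\<close>

lemma polynomial_isometric:
  assumes \<beta>: "gauge_action L p s \<beta>"
    and invariant: "\<And>t x. norm (\<pi> (\<beta> (cis t) x)) \<le> norm (\<pi> x)"
    and x: "x \<in> dom.polynomials (int d)"
  shows "norm x \<le> norm (\<pi> x)"
proof (rule norm_le_if_powers_linear[OF star_hom])
  fix n
  let ?h = "star x * x" and ?C = "4 * real d + 1"
  have h: "iter_square n ?h \<in> dom.polynomials (2 ^ n * (2 * int d))"
  proof (induction n)
    case 0
    then show ?case using dom.polynomials_mult[OF dom.star_polynomials[OF x] x] by simp
  next
    case (Suc n)
    show ?case using dom.polynomials_mult[OF Suc Suc] by (simp add: mult_ac)
  qed
  have "norm (iter_square n ?h) \<le> (2 * real_of_int (2 ^ n * (2 * int d)) + 1) * norm (\<pi> (iter_square n ?h))"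
    by (rule norm_polynomial_le[OF \<beta> invariant h]) simp
  also have "\<dots> \<le> ?C * 2 ^ n * norm (\<pi> (iter_square n ?h))"
    by (intro mult_right_mono) (auto simp: algebra_simps)
  finally show "norm (iter_square n ?h) \<le> ?C * 2 ^ n * norm (\<pi> (iter_square n ?h))" .
qed

lemma injective_if_invariant:
  assumes \<beta>: "gauge_action L p s \<beta>"
    and invariant: "\<And>t x. norm (\<pi> (\<beta> (cis t) x)) \<le> norm (\<pi> x)"
    and gen: "ck_algebra L p s = UNIV"
  shows "inj \<pi>"
proof -
  have "norm x \<le> norm (\<pi> x)" for x
  proof -
    have "x \<in> closure (\<Union>d. dom.polynomials (int d))" using dom.polynomials_dense gen by blast
    then obtain X where X: "\<And>n. X n \<in> (\<Union>d. dom.polynomials (int d))" "X \<longlonglongrightarrow> x"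
      by (metis closure_sequential)
    have le: "norm (X n) \<le> norm (\<pi> x) + norm (X n - x)" for n
    proof -
      have "norm (X n) \<le> norm (\<pi> (X n))"
        using X(1)[of n] polynomial_isometric[OF \<beta> invariant] by blast
      also have "\<dots> \<le> norm (\<pi> x) + norm (\<pi> (X n - x))"
        using norm_triangle_ineq[of "\<pi> x" "\<pi> (X n - x)"] by (simp add: \<pi>_diff)
      finally show ?thesis using norm_\<pi>_le[of "X n - x"] by linarith
    qed
    have "(\<lambda>n. norm (\<pi> x) + norm (X n - x)) \<longlonglongrightarrow> norm (\<pi> x) + 0"
      using X(2) by (intro tendsto_intros) (simp add: LIM_zero tendsto_norm_zero)
    with tendsto_norm[OF X(2)] have "norm x \<le> norm (\<pi> x) + 0"
      by (rule LIMSEQ_le) (use le in blast)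
    then show ?thesis by simp
  qed
  note lower_bound = this
  show ?thesis
  proof (rule injI)
    fix x y assume "\<pi> x = \<pi> y"
    then show "x = y" using lower_bound[of "x - y"] by (simp add: \<pi>_diff)
  qed
qed

text \<open>
  The action \<open>\<gamma>\<close> is only given on \<open>ck_algebra L P S\<close>, so its contractivity is available at \<open>\<pi> x\<close> only once \<open>\<pi> x\<close>
  is known to lie there. The preimage of that algebra is closed, as \<open>\<pi>\<close> is continuous.
\<close>

lemma \<pi>_in_ck_algebra:
  assumes gen: "ck_algebra L p s = UNIV" shows "\<pi> x \<in> ck_algebra L P S"
proof -
  let ?X = "ck_algebra L P S"
  have X: "cstar_subalgebra ?X" by (rule cstar_subalgebra_ck_algebra)
  have sub: "range P \<subseteq> ?X" "S ` L \<subseteq> ?X"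
    unfolding ck_algebra_def using hull_subset[of "range P \<union> S ` L"] by blast+
  have "continuous_on UNIV \<pi>"
    unfolding continuous_on_iff dist_norm \<pi>_diff[symmetric]
    using norm_\<pi>_le by (meson order_le_less_trans)
  then have "closed (\<pi> -` ?X)"
    using X by (intro closed_vimage) (auto simp: cstar_subalgebra_def)
  then have "cstar_subalgebra (\<pi> -` ?X)"
    using X by (simp add: cstar_subalgebra_def \<pi>_zero \<pi>_add \<pi>_mult \<pi>_star \<pi>_scaleC)
  then have "ck_algebra L p s \<subseteq> \<pi> -` ?X"
    by (rule ck_algebra_minimal) (use sub \<pi>_p \<pi>_s in auto)
  then show ?thesis using gen by blast
qed

end

theorem theorem5p10:
  fixes L :: "'l set"
    and \<theta> :: "'l \<Rightarrow> 'b::generalized_boolean_algebra \<Rightarrow> 'b"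
    and p :: "'b \<Rightarrow> 'u::cstar_algebra" and s :: "'l \<Rightarrow> 'u"
    and \<beta> :: "complex \<Rightarrow> 'u \<Rightarrow> 'u"
    and P :: "'b \<Rightarrow> 'a::cstar_algebra" and S :: "'l \<Rightarrow> 'a"
    and \<pi> :: "'u \<Rightarrow> 'a"
    and \<gamma> :: "complex \<Rightarrow> 'a \<Rightarrow> 'a"
  assumes "boolean_dynamical_system L \<theta>"
    and "universal_ck L \<theta> p s"
    and "gauge_action L p s \<beta>"
    and "ck_representation L \<theta> cstar_univ P S"
    and "star_hom cstar_univ cstar_univ \<pi>"
    and "\<And>A. \<pi> (p A) = P A"
    and "\<And>\<alpha>. \<alpha> \<in> L \<Longrightarrow> \<pi> (s \<alpha>) = S \<alpha>"
    and "\<And>A. A \<noteq> bot \<Longrightarrow> P A \<noteq> 0"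
    and "circle_action (ck_algebra L P S) \<gamma>"
    and "\<And>z x. z \<in> sphere 0 1 \<Longrightarrow> \<gamma> z (\<pi> x) = \<pi> (\<beta> z x)"
  shows "inj \<pi>"
proof -
  have ck: "ck_representation L \<theta> cstar_univ p s" and gen: "ck_algebra L p s = UNIV"
    using assms(2) by (auto simp: universal_ck_def)
  interpret ck_morphism L \<theta> p s P S \<pi>
    by unfold_locales (fact assms ck)+
  have "norm (\<pi> (\<beta> (cis t) x)) \<le> norm (\<pi> x)" for t x
  proof -
    have z: "cis t \<in> sphere 0 1" by simp
    have "star_hom (cstar_on (ck_algebra L P S)) (cstar_on (ck_algebra L P S)) (\<gamma> (cis t))"
      using assms(9) z unfolding circle_action_def by blast
    then have "norm (\<gamma> (cis t) (\<pi> x)) \<le> norm (\<pi> x)"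
      by (rule star_hom_contractive[OF cstar_subalgebra_ck_algebra]) (rule \<pi>_in_ck_algebra[OF gen])
    then show ?thesis using assms(10)[OF z] by simp
  qed
  with assms(3) show ?thesis using gen by (rule injective_if_invariant)
qed

end
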